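(* Let two independent sequences of lengths $m$ and $n$ consist of i.i.d. letters from $\{0,1\}$, each letter being $0$ with probability $\frac12$. Let $X$ and $Y$ be the numbers of occurrences of $0$ in the first and second sequence, $D_2=XY+(m-X)(n-Y)$, and $$W=\frac{D_2-\mathbb{E}D_2}{\sqrt{\mathrm{Var}(D_2)}}=\Big(\frac{X-\frac m2}{\sqrt{m/4}}\Big)\Big(\frac{Y-\frac n2}{\sqrt{n/4}}\Big).$$ Let $Z\sim\mathrm{SVG}(1,1,0)$. Then $$d_{\mathrm W}(W,Z)\le20.11\Big(\frac1{\sqrt m}+\frac1{\sqrt n}\Big),\qquad d_{\mathrm K}(W,Z)\le\Big\{44.33+2.02\log\Big(\frac{mn}{m+n}\Big)\Big\}\Big(\frac1m+\frac1n\Big)^{1/3}.$$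
   Context: $\mathrm{SVG}(1,1,0)$ is the distribution with density $\frac1\pi K_0(|x|)$, $K_0$ the modified Bessel function of the second kind of order 0. $d_{\mathrm K}$ is the Kolmogorov distance and $d_{\mathrm W}$ the Wasserstein distance (sup over Lipschitz test functions with constant $\le1$). *)

theory Defs
  imports "HOL-Probability.Probability"
begin

text \<open>Modified Bessel function of the second kind of order 0, via its standard
  integral representation  K_0(x) = int_0^infty exp(-x cosh t) dt  (x > 0).\<close>
definition bessel_K0 :: "real \<Rightarrow> real" where
  "bessel_K0 x = (LINT t:{0..}|lborel. exp (- x * cosh t))"

definition SVG_110 :: "real measure" where
  "SVG_110 = density lborel (\<lambda>x. ennreal (bessel_K0 \<bar>x\<bar> / pi))"

definition wasserstein_dist :: "real measure \<Rightarrow> real measure \<Rightarrow> ereal" where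
  "wasserstein_dist M N =
     (SUP h \<in> {h :: real \<Rightarrow> real. 1-lipschitz_on UNIV h}.
        ereal \<bar>integral\<^sup>L M h - integral\<^sup>L N h\<bar>)"

definition kolmogorov_dist :: "real measure \<Rightarrow> real measure \<Rightarrow> ereal" where
  "kolmogorov_dist M N =
     (SUP z :: real. ereal \<bar>measure M {..z} - measure N {..z}\<bar>)"

definition W_law :: "nat \<Rightarrow> nat \<Rightarrow> real measure" where
  "W_law m n = measure_pmf
     (map_pmf (\<lambda>(X, Y). ((real X - real m / 2) / sqrt (real m / 4)) *
                          ((real Y - real n / 2) / sqrt (real n / 4)))
        (pair_pmf (binomial_pmf m (1/2)) (binomial_pmf n (1/2))))"

end

theory Submission
  imports Defs "HOL-Real_Asymp.Real_Asymp"
begin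

text \<open>
  \<open>SVG(1,1,0)\<close> is the law of the product of two independent standard normal variables, and \<open>W\<close> is
  the product of two independent standardised binomials, so it suffices to replace the factors one
  at a time by normal ones, using bounds for a single factor that hold uniformly (Kolmogorov) or
  linearly (Wasserstein) in the value of the other factor.

  A single factor is handled by Stein's method. Let \<open>f\<close> solve \<open>f'(x) = x f(x) + h(x) - E h(N)\<close>. With
  nodes \<open>x\<^sub>j = (2 j - m) / sqrt m\<close> of spacing \<open>\<delta> = 2 / sqrt m\<close> and the weights \<open>p\<^sub>j\<close> of the symmetric
  binomial law with \<open>m - 1\<close> trials, the standardised binomial \<open>S\<close> satisfies
  \<open>E (S f(S)) = \<Sum> p\<^sub>j (f(x\<^sub>j\<^sub>+\<^sub>1) - f(x\<^sub>j)) / \<delta>\<close>, which by the mean value theorem is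
  \<open>\<Sum> p\<^sub>j f'(u\<^sub>j)\<close> with \<open>x\<^sub>j \<le> u\<^sub>j \<le> x\<^sub>j\<^sub>+\<^sub>1\<close>, a discrete form of zero biasing. Since also
  \<open>E g(S) = \<Sum> p\<^sub>j (g(x\<^sub>j) + g(x\<^sub>j\<^sub>+\<^sub>1)) / 2\<close>, bounds on \<open>f\<close> and \<open>f'\<close> alone show that
  \<open>\<Sum> p\<^sub>j h(u\<^sub>j)\<close> is within \<open>O(\<delta>)\<close> of \<open>E h(N)\<close>. For Lipschitz \<open>h\<close>, and for ramps \<open>h\<close> approximating
  indicators of half-lines, this transfers to \<open>S\<close> at the cost of another \<open>O(\<delta>)\<close>. The resulting
  rate \<open>1 / sqrt m + 1 / sqrt n\<close> also beats the claimed Kolmogorov rate.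
\<close>

section \<open>Symmetric binomial distributions\<close>

text \<open>The value \<open>(j - m/2) / sqrt (m/4)\<close> of the standardised binomial at
  \<open>j\<close> successes, with the inner fractions cleared.\<close>

definition binomial_node :: "nat \<Rightarrow> nat \<Rightarrow> real" where
  "binomial_node m j = (2 * real j - real m) / sqrt (real m)"

text \<open>Kept as a finite sum rather than an integral, so that linearity and interchanges need no
  integrability; \<open>integral_W_law\<close> makes the link to \<open>W_law\<close>.\<close>

definition binomial_mean :: "nat \<Rightarrow> (real \<Rightarrow> real) \<Rightarrow> real" where
  "binomial_mean m g = (\<Sum>j\<le>m. real (m choose j) / 2 ^ m * g (binomial_node m j))"

lemma binomial_node_Suc:
  assumes "m \<ge> 1"
  shows "binomial_node m (Suc j) = binomial_node m j + 2 / sqrt (real m)"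
  using assms by (simp add: binomial_node_def field_simps)

text \<open>Absorption: the term \<open>j = 0\<close> vanishes and
  \<open>j * (k+1 choose j) = (k+1) * (k choose j-1)\<close>. Adding this identity to the upper one
  below yields Pascal averaging; subtracting the upper one yields Stein's identity.\<close>

lemma sum_binomial_weighted_lower:
  fixes g :: "nat \<Rightarrow> real"
  shows "(\<Sum>j\<le>Suc k. real (Suc k choose j) * real j * g j)
           = real (Suc k) * (\<Sum>j\<le>k. real (k choose j) * g (Suc j))"
proof -
  have "(\<Sum>j\<le>Suc k. real (Suc k choose j) * real j * g j)
          = (\<Sum>j\<le>k. real (Suc j * (Suc k choose Suc j)) * g (Suc j))"
    unfolding sum.atMost_Suc_shift by (simp add: mult_ac del: binomial_Suc_Suc of_nat_Suc mult_Suc mult_Suc_right)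
  also have "\<dots> = (\<Sum>j\<le>k. real (Suc k) * (real (k choose j) * g (Suc j)))"
    by (simp only: Suc_times_binomial of_nat_mult mult.assoc)
  finally show ?thesis by (simp only: sum_distrib_left)
qed

lemma sum_binomial_weighted_upper:
  fixes g :: "nat \<Rightarrow> real"
  shows "(\<Sum>j\<le>Suc k. real (Suc k choose j) * (real (Suc k) - real j) * g j)
           = real (Suc k) * (\<Sum>j\<le>k. real (k choose j) * g j)"
proof -
  have "(\<Sum>j\<le>Suc k. real (Suc k choose j) * (real (Suc k) - real j) * g j)
          = (\<Sum>j\<le>k. real ((Suc k - j) * (Suc k choose j)) * g j)"
    unfolding sum.atMost_Suc by (simp add: of_nat_diff mult_ac)
  also have "\<dots> = (\<Sum>j\<le>k. real (Suc k) * (real (k choose j) * g j))"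
    by (simp only: binomial_absorb_comp of_nat_mult mult.assoc diff_Suc_1)
  finally show ?thesis by (simp only: sum_distrib_left)
qed

text \<open>Given the first \<open>k\<close> trials, the last one selects the left or the right node
  with equal probability. Algebraically, the weights \<open>j\<close> and \<open>Suc k - j\<close>
  add up to \<open>Suc k\<close>, which cancels.\<close>

lemma binomial_mean_pascal:
  "binomial_mean (Suc k) g = (\<Sum>j\<le>k. real (k choose j) / 2 ^ k *
     ((g (binomial_node (Suc k) j) + g (binomial_node (Suc k) (Suc j))) / 2))"
proof -
  let ?g = "\<lambda>j. g (binomial_node (Suc k) j)"
  have "real (Suc k) * (\<Sum>j\<le>Suc k. real (Suc k choose j) * ?g j)
      = (\<Sum>j\<le>Suc k. real (Suc k choose j) * real j * ?g j)
        + (\<Sum>j\<le>Suc k. real (Suc k choose j) * (real (Suc k) - real j) * ?g j)"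
    unfolding sum_distrib_left sum.distrib[symmetric] by (intro sum.cong) (simp_all add: algebra_simps)
  also have "\<dots> = real (Suc k) * (\<Sum>j\<le>k. real (k choose j) * (?g j + ?g (Suc j)))"
    unfolding sum_binomial_weighted_lower sum_binomial_weighted_upper
    by (simp only: distrib_left sum.distrib add.commute)
  finally have "(\<Sum>j\<le>Suc k. real (Suc k choose j) * ?g j)
      = (\<Sum>j\<le>k. real (k choose j) * (?g j + ?g (Suc j)))"
    by (simp del: sum.atMost_Suc of_nat_Suc)
  moreover have "binomial_mean (Suc k) g = (\<Sum>j\<le>Suc k. real (Suc k choose j) * ?g j) / 2 ^ Suc k"
    by (simp only: binomial_mean_def sum_divide_distrib times_divide_eq_left)
  ultimately show ?thesis
    by (simp add: sum_divide_distrib mult.commute)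
qed

text \<open>Discrete Gaussian integration by parts. The numerator of the node is
  \<open>2 * j - m = j - (m - j)\<close>, so the two weighted sums are subtracted, which produces
  difference quotients over single cells.\<close>

lemma binomial_mean_stein:
  "binomial_mean (Suc k) (\<lambda>x. x * g x) = (\<Sum>j\<le>k. real (k choose j) / 2 ^ k *
     ((g (binomial_node (Suc k) (Suc j)) - g (binomial_node (Suc k) j)) / (2 / sqrt (real (Suc k)))))"
proof -
  let ?m = "Suc k"
  let ?g = "\<lambda>j. g (binomial_node ?m j)"
  have "(\<Sum>j\<le>?m. real (?m choose j) * (2 * real j - real ?m) * ?g j)
      = (\<Sum>j\<le>?m. real (?m choose j) * real j * ?g j)
        - (\<Sum>j\<le>?m. real (?m choose j) * (real ?m - real j) * ?g j)"
    unfolding sum_subtractf[symmetric] by (intro sum.cong) (simp_all add: algebra_simps)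
  also have "\<dots> = real ?m * (\<Sum>j\<le>k. real (k choose j) * (?g (Suc j) - ?g j))"
    unfolding sum_binomial_weighted_lower sum_binomial_weighted_upper
    by (simp only: right_diff_distrib sum_subtractf)
  finally have *: "(\<Sum>j\<le>?m. real (?m choose j) * (2 * real j - real ?m) * ?g j)
      = real ?m * (\<Sum>j\<le>k. real (k choose j) * (?g (Suc j) - ?g j))" .
  have "binomial_mean ?m (\<lambda>x. x * g x)
      = (\<Sum>j\<le>?m. real (?m choose j) * (2 * real j - real ?m) * ?g j) / (2 ^ ?m * sqrt (real ?m))"
    unfolding binomial_mean_def sum_divide_distrib by (intro sum.cong) (simp_all add: binomial_node_def)
  also have "\<dots> = (real ?m / sqrt (real ?m)) / 2 * (\<Sum>j\<le>k. real (k choose j) * (?g (Suc j) - ?g j)) / 2 ^ k"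
    unfolding * by simp
  also have "real ?m / sqrt (real ?m) = sqrt (real ?m)"
    by (rule real_div_sqrt) simp
  finally show ?thesis
    by (simp add: sum_divide_distrib sum_distrib_left mult_ac)
qed

lemma binomial_half_weights_sum: "(\<Sum>j\<le>k. real (k choose j) / 2 ^ k) = 1"
proof -
  have "(\<Sum>j\<le>k. real (k choose j)) = 2 ^ k"
    using choose_row_sum[of k] by (metis of_nat_numeral of_nat_power of_nat_sum)
  then show ?thesis by (simp add: sum_divide_distrib[symmetric])
qed

lemma binomial_mean_const: "binomial_mean m (\<lambda>_. c) = c"
  unfolding binomial_mean_def by (simp only: sum_distrib_right[symmetric] binomial_half_weights_sum mult_1)

lemma binomial_mean_mono:
  assumes "\<And>x. f x \<le> g x"
  shows "binomial_mean m f \<le> binomial_mean m g"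
  unfolding binomial_mean_def by (intro sum_mono mult_left_mono assms) simp

lemma binomial_mean_add: "binomial_mean m (\<lambda>x. f x + g x) = binomial_mean m f + binomial_mean m g"
  by (simp add: binomial_mean_def distrib_left sum.distrib)

lemma binomial_mean_diff: "binomial_mean m (\<lambda>x. f x - g x) = binomial_mean m f - binomial_mean m g"
  by (simp add: binomial_mean_def right_diff_distrib sum_subtractf)

lemma binomial_mean_cmult: "binomial_mean m (\<lambda>x. c * f x) = c * binomial_mean m f"
  by (simp add: binomial_mean_def sum_distrib_left mult_ac)

lemma binomial_mean_abs_le: "\<bar>binomial_mean m f\<bar> \<le> binomial_mean m (\<lambda>x. \<bar>f x\<bar>)"
  unfolding binomial_mean_def by (rule order_trans[OF sum_abs]) (simp add: abs_mult)

lemma binomial_mean_square: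
  assumes "m \<ge> 1" shows "binomial_mean m (\<lambda>x. x * x) = 1"
proof -
  obtain k where m: "m = Suc k" using assms by (cases m) auto
  have "binomial_mean m (\<lambda>x. x * x) = (\<Sum>j\<le>k. real (k choose j) / 2 ^ k * 1)"
    \<comment> \<open>Stein's identity for the identity function: every difference quotient is
      1.\<close>
    unfolding m binomial_mean_stein by (intro sum.cong) (simp_all add: binomial_node_Suc)
  then show ?thesis by (simp add: binomial_half_weights_sum del: times_divide_eq_left)
qed

lemma binomial_mean_abs_id:
  assumes "m \<ge> 1" shows "binomial_mean m abs \<le> 1"
proof -
  \<comment> \<open>The inequality \<open>2 * |x| <= 1 + x^2\<close> reduces the first absolute
    moment to the second moment, which equals 1.\<close>
  have "\<bar>x\<bar> \<le> 1 / 2 + 1 / 2 * (x * x)" for x :: real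
    using zero_le_power2[of "\<bar>x\<bar> - 1"] by (simp add: power2_eq_square algebra_simps)
  then have "binomial_mean m abs \<le> binomial_mean m (\<lambda>x. 1 / 2 + 1 / 2 * (x * x))"
    by (rule binomial_mean_mono)
  also have "\<dots> = 1"
    unfolding binomial_mean_add binomial_mean_cmult binomial_mean_const binomial_mean_square[OF assms] by simp
  finally show ?thesis .
qed

section \<open>Stein's method for a single binomial factor\<close>

text \<open>With \<open>g y = y * f y\<close>, the mean of \<open>g\<close> is computed twice: as an
  average over cell endpoints by Pascal, and as the weighted sum of
  \<open>f' (u j) = g (u j) + h (u j) - c\<close> by Stein's identity. Subtracting leaves
  differences of \<open>g\<close> within one cell. No regularity of \<open>h\<close> enters the
  error, which is why \<open>h\<close> is evaluated at \<open>u j\<close> and not at the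
  nodes.\<close>

lemma binomial_stein_comparison:
  fixes f h :: "real \<Rightarrow> real"
  assumes deriv: "\<And>x. (f has_real_derivative x * f x + (h x - c)) (at x)"
    and f_bound: "\<And>x. \<bar>f x\<bar> \<le> A"
    and f'_bound: "\<And>x. \<bar>x * f x + (h x - c)\<bar> \<le> B"
  obtains u where
    "\<And>j. binomial_node (Suc k) j \<le> u j \<and> u j \<le> binomial_node (Suc k) (Suc j)"
    "\<bar>(\<Sum>j\<le>k. real (k choose j) / 2 ^ k * h (u j)) - c\<bar> \<le> 2 / sqrt (real (Suc k)) * (A + B)"
proof -
  define d where "d = 2 / sqrt (real (Suc k))"
  define x where "x = binomial_node (Suc k)"
  define w where "w = (\<lambda>j. real (k choose j) / 2 ^ k)"
  define g where "g = (\<lambda>y. y * f y)"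
  have d: "d > 0" by (simp add: d_def)
  have x: "x (Suc j) = x j + d" for j
    by (simp add: x_def d_def binomial_node_Suc)
  have w: "w j \<ge> 0" for j by (simp add: w_def)
  have w_sum: "sum w {..k} = 1" unfolding w_def by (rule binomial_half_weights_sum)
  have "\<exists>u. x j \<le> u \<and> u \<le> x (Suc j) \<and> f (x (Suc j)) - f (x j) = d * (u * f u + (h u - c))" for j
  proof -
    have "\<exists>z>x j. z < x (Suc j) \<and> f (x (Suc j)) - f (x j) = (x (Suc j) - x j) * (z * f z + (h z - c))"
      by (rule MVT2) (auto simp: x d deriv)
    then show ?thesis by (auto simp: x intro: less_imp_le)
  qed
  then obtain u where u: "\<And>j. x j \<le> u j \<and> u j \<le> x (Suc j)"
    and fu: "\<And>j. f (x (Suc j)) - f (x j) = d * (u j * f (u j) + (h (u j) - c))"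
    by metis
  have lip: "\<bar>f a - f b\<bar> \<le> B * \<bar>a - b\<bar>" for a b
    using field_differentiable_bound[of UNIV f "\<lambda>x. x * f x + (h x - c)" B a b] deriv f'_bound
    by (auto simp: dist_norm)
  \<comment> \<open>Product rule for differences. The unbounded factor is attached to
    \<open>a\<close>, later a node, and not to \<open>b\<close>, later \<open>u j\<close>, so that
    its weighted sum becomes the first absolute moment of the binomial.\<close>
  have g_diff: "\<bar>g a - g b\<bar> \<le> \<bar>a\<bar> * (B * d) + d * A" if "\<bar>a - b\<bar> \<le> d" for a b
  proof -
    have "B \<ge> 0" using f'_bound[of 0] by linarith
    have "g a - g b = a * (f a - f b) + (a - b) * f b"
      by (simp add: g_def algebra_simps)
    then have "\<bar>g a - g b\<bar> \<le> \<bar>a\<bar> * \<bar>f a - f b\<bar> + \<bar>a - b\<bar> * \<bar>f b\<bar>"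
      by (metis abs_mult abs_triangle_ineq)
    also have "\<bar>f a - f b\<bar> \<le> B * d"
      using lip[of a b] mult_left_mono[OF that \<open>B \<ge> 0\<close>] by linarith
    also have "\<bar>a - b\<bar> * \<bar>f b\<bar> \<le> d * A"
      using that f_bound d by (intro mult_mono) auto
    finally show ?thesis by (simp add: mult_left_mono)
  qed
  have "(\<Sum>j\<le>k. w j * ((g (x j) + g (x (Suc j))) / 2)) = binomial_mean (Suc k) g"
    unfolding binomial_mean_pascal w_def x_def ..
  also have "\<dots> = (\<Sum>j\<le>k. w j * (g (u j) + (h (u j) - c)))"
    unfolding g_def binomial_mean_stein x_def[symmetric] d_def[symmetric] fu
    using d by (intro sum.cong) (auto simp: w_def)
  also have "\<dots> = (\<Sum>j\<le>k. w j * g (u j)) + (\<Sum>j\<le>k. w j * h (u j)) - c"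
    using w_sum
    by (simp add: distrib_left right_diff_distrib sum.distrib sum_subtractf
        sum_distrib_right[symmetric])
  finally have "(\<Sum>j\<le>k. w j * h (u j)) - c
      = (\<Sum>j\<le>k. w j * ((g (x j) - g (u j)) / 2 + (g (x (Suc j)) - g (u j)) / 2))"
    by (simp add: sum.distrib sum_subtractf add_divide_distrib diff_divide_distrib distrib_left
        right_diff_distrib sum_divide_distrib[symmetric])
  also have "\<bar>\<dots>\<bar> \<le> (\<Sum>j\<le>k. w j * ((\<bar>x j\<bar> + \<bar>x (Suc j)\<bar>) / 2 * (B * d) + d * A))"
  proof (rule order_trans[OF sum_abs], rule sum_mono)
    fix j
    have "\<bar>g (x j) - g (u j)\<bar> \<le> \<bar>x j\<bar> * (B * d) + d * A"
      "\<bar>g (x (Suc j)) - g (u j)\<bar> \<le> \<bar>x (Suc j)\<bar> * (B * d) + d * A"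
      using u[of j] x[of j] by (auto intro!: g_diff)
    then have "\<bar>(g (x j) - g (u j)) / 2 + (g (x (Suc j)) - g (u j)) / 2\<bar>
        \<le> (\<bar>x j\<bar> + \<bar>x (Suc j)\<bar>) / 2 * (B * d) + d * A"
      by (simp add: distrib_right add_divide_distrib) argo
    then show "\<bar>w j * ((g (x j) - g (u j)) / 2 + (g (x (Suc j)) - g (u j)) / 2)\<bar>
        \<le> w j * ((\<bar>x j\<bar> + \<bar>x (Suc j)\<bar>) / 2 * (B * d) + d * A)"
      using w[of j] by (simp only: abs_mult abs_of_nonneg mult_left_mono)
  qed
  \<comment> \<open>Pascal averaging read backwards, applied to \<open>abs\<close>.\<close>
  also have "\<dots> = binomial_mean (Suc k) abs * (B * d) + d * A"
    unfolding binomial_mean_pascal w_def[symmetric] x_def[symmetric] distrib_left sum.distrib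
      mult.assoc[symmetric] sum_distrib_right[symmetric] w_sum
    by (simp add: w_def x_def add_divide_distrib distrib_left sum.distrib)
  also have "\<dots> \<le> 1 * (B * d) + d * A"
    using binomial_mean_abs_id[of "Suc k"] f'_bound[of 0] d
    by (intro add_right_mono mult_right_mono) auto
  finally have "\<bar>(\<Sum>j\<le>k. w j * h (u j)) - c\<bar> \<le> d * (A + B)"
    by (simp add: algebra_simps)
  then show ?thesis
    using that[of u] u by (simp add: w_def x_def d_def)
qed

section \<open>The law of the product statistic as an iterated binomial mean\<close>

lemma integral_W_law:
  fixes h :: "real \<Rightarrow> real"
  shows "integral\<^sup>L (W_law m n) h = binomial_mean m (\<lambda>x. binomial_mean n (\<lambda>y. h (x * y)))"
proof -
  have node: "(real j - real m / 2) / sqrt (real m / 4) = binomial_node m j" for j m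
    by (simp add: binomial_node_def real_sqrt_divide diff_divide_distrib)
  have pm: "pmf (binomial_pmf m (1/2)) j = real (m choose j) / 2 ^ m" if "j \<le> m" for m j
    using that by (simp add: power_add[symmetric] power_divide divide_simps)
  have "integral\<^sup>L (W_law m n) h = (\<Sum>(j, l)\<in>{..m} \<times> {..n}.
      h (binomial_node m j * binomial_node n l)
        * (pmf (binomial_pmf m (1/2)) j * pmf (binomial_pmf n (1/2)) l))"
    unfolding W_law_def integral_map_pmf node
    by (subst integral_measure_pmf_real[of "{..m} \<times> {..n}"])
       (auto simp: pmf_pair case_prod_beta intro!: sum.cong)
  also have "\<dots> = (\<Sum>(j, l)\<in>{..m} \<times> {..n}.
      h (binomial_node m j * binomial_node n l) * (real (m choose j) / 2 ^ m * (real (n choose l) / 2 ^ n)))"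
    by (intro sum.cong) (auto simp: pm simp del: pmf_binomial)
  also have "\<dots> = binomial_mean m (\<lambda>x. binomial_mean n (\<lambda>y. h (x * y)))"
    unfolding binomial_mean_def sum_distrib_left sum.cartesian_product
    by (intro sum.cong) auto
  finally show ?thesis .
qed

section \<open>The product normal distribution\<close>

lemma borel_measurable_cosh [measurable]: "(cosh :: real \<Rightarrow> real) \<in> borel_measurable borel"
  by (intro borel_measurable_continuous_onI continuous_intros)

text \<open>The substitution \<open>x = exp t\<close> is made on compact intervals. These exhaust
  both sides, and continuity from below of the two density measures passes to the supremum.\<close>

lemma nn_integral_exp_substitution:
  fixes f :: "real \<Rightarrow> ennreal"
  assumes [measurable]: "f \<in> borel_measurable borel"
  shows "(\<integral>\<^sup>+x. f x * indicator {0<..} x \<partial>lborel) = (\<integral>\<^sup>+t. f (exp t) * ennreal (exp t) \<partial>lborel)"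
proof -
  have range: "{0<..} = (\<Union>i::nat. {exp (- real (Suc i))..exp (real (Suc i))})"
  proof safe
    fix x :: real assume "x > 0"
    obtain i :: nat where "\<bar>ln x\<bar> \<le> real (Suc i)" using real_arch_simple by (metis lift_Suc_mono_le order_trans of_nat_le_iff le_SucI order_refl)
    then have "- real (Suc i) \<le> ln x" "ln x \<le> real (Suc i)" by auto
    then have "exp (- real (Suc i)) \<le> exp (ln x)" "exp (ln x) \<le> exp (real (Suc i))" by simp_all
    then show "x \<in> (\<Union>i::nat. {exp (- real (Suc i))..exp (real (Suc i))})" using \<open>x > 0\<close> by auto
  next
    fix x :: real and i :: nat assume "x \<in> {exp (- real (Suc i))..exp (real (Suc i))}"
    then show "0 < x" using exp_gt_zero[of "- real (Suc i)"] by (simp del: exp_gt_zero)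
  qed
  have domain: "UNIV = (\<Union>i::nat. {- real (Suc i)..real (Suc i)})"
  proof safe
    fix x :: real
    obtain i :: nat where "\<bar>x\<bar> \<le> real (Suc i)" using real_arch_simple by (metis lift_Suc_mono_le order_trans of_nat_le_iff le_SucI order_refl)
    then show "x \<in> (\<Union>i::nat. {- real (Suc i)..real (Suc i)})" by (auto intro!: exI[of _ i])
  qed auto
  have inc: "incseq (\<lambda>i::nat. {exp (- real (Suc i))..exp (real (Suc i))})" "incseq (\<lambda>i::nat. {- real (Suc i)..real (Suc i)})"
    by (auto simp: incseq_def intro: order_trans)
  have "(\<integral>\<^sup>+x. f x * indicator {0<..} x \<partial>lborel) = emeasure (density lborel f) {0<..}"
    by (simp add: emeasure_density)
  also have "\<dots> = (SUP i::nat. emeasure (density lborel f) {exp (- real (Suc i))..exp (real (Suc i))})"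
    unfolding range by (rule SUP_emeasure_incseq[symmetric]) (use inc in auto)
  also have "\<dots> = (SUP i::nat. \<integral>\<^sup>+x. f x * indicator {exp (- real (Suc i))..exp (real (Suc i))} x \<partial>lborel)"
    by (simp add: emeasure_density)
  also have "\<dots> = (SUP i::nat. \<integral>\<^sup>+t. f (exp t) * ennreal (exp t) * indicator {- real (Suc i)..real (Suc i)} t \<partial>lborel)"
    by (subst nn_integral_substitution_aux[where g = exp and g' = exp])
       (auto intro!: derivative_eq_intros continuous_intros)
  also have "\<dots> = (SUP i::nat. emeasure (density lborel (\<lambda>t. f (exp t) * ennreal (exp t))) {- real (Suc i)..real (Suc i)})"
    by (simp add: emeasure_density)
  also have "\<dots> = emeasure (density lborel (\<lambda>t. f (exp t) * ennreal (exp t))) UNIV"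
    unfolding domain by (rule SUP_emeasure_incseq) (use inc in auto)
  also have "\<dots> = (\<integral>\<^sup>+t. f (exp t) * ennreal (exp t) \<partial>lborel)"
    by (simp add: emeasure_density)
  finally show ?thesis .
qed

lemma nn_integral_even:
  fixes f :: "real \<Rightarrow> ennreal"
  assumes [measurable]: "f \<in> borel_measurable borel" and even: "\<And>x. f (- x) = f x"
  shows "(\<integral>\<^sup>+x. f x \<partial>lborel) = 2 * (\<integral>\<^sup>+x. f x * indicator {0<..} x \<partial>lborel)"
proof -
  have "(\<integral>\<^sup>+x. f x \<partial>lborel)
      = (\<integral>\<^sup>+x. f x * indicator {0<..} x + f x * indicator {..<0} x \<partial>lborel)"
    by (intro nn_integral_cong_AE eventually_mono[OF AE_lborel_singleton[of "0::real"]])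
       (auto split: split_indicator)
  also have "\<dots> = (\<integral>\<^sup>+x. f x * indicator {0<..} x \<partial>lborel) + (\<integral>\<^sup>+x. f x * indicator {..<0} x \<partial>lborel)"
    by (rule nn_integral_add) auto
  also have "(\<integral>\<^sup>+x. f x * indicator {..<0} x \<partial>lborel) = (\<integral>\<^sup>+x. f x * indicator {0<..} x \<partial>lborel)"
    by (subst nn_integral_real_affine[where c = "-1" and t = 0])
       (auto simp: even intro!: nn_integral_cong split: split_indicator)
  finally show ?thesis by (simp add: mult_2)
qed

text \<open>The substitution is x = sqrt z * exp (t / 2).\<close>

lemma nn_integral_normal_product_density:
  assumes z: "z > 0"
  shows "(\<integral>\<^sup>+x. ennreal (std_normal_density x * std_normal_density (z / x) / \<bar>x\<bar>) \<partial>lborel)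
       = ennreal (1 / pi) * (\<integral>\<^sup>+t. ennreal (exp (- z * cosh t)) * indicator {0..} t \<partial>lborel)"
proof -
  let ?e = "\<lambda>t. ennreal (exp (- z * cosh t))"
  have "(\<integral>\<^sup>+x. ennreal (std_normal_density x * std_normal_density (z / x) / \<bar>x\<bar>) \<partial>lborel)
      = 2 * (\<integral>\<^sup>+x. ennreal (std_normal_density x * std_normal_density (z / x) / \<bar>x\<bar>) * indicator {0<..} x \<partial>lborel)"
    by (rule nn_integral_even) (auto simp: std_normal_density_def)
  \<comment> \<open>The Jacobian \<open>exp t\<close> cancels the factor
    \<open>1 / |x|\<close>.\<close>
  also have "(\<integral>\<^sup>+x. ennreal (std_normal_density x * std_normal_density (z / x) / \<bar>x\<bar>) * indicator {0<..} x \<partial>lborel)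
      = (\<integral>\<^sup>+t. ennreal (std_normal_density (exp t) * std_normal_density (z / exp t)) \<partial>lborel)"
    by (subst nn_integral_exp_substitution) (auto simp: ennreal_mult'[symmetric])
  also have "\<dots> = ennreal (1 / 2) * (\<integral>\<^sup>+t. ennreal (std_normal_density (exp (ln z / 2 + 1 / 2 * t))
      * std_normal_density (z / exp (ln z / 2 + 1 / 2 * t))) \<partial>lborel)"
    by (subst nn_integral_real_affine[where c = "1 / 2" and t = "ln z / 2"]) auto
  also have "(\<lambda>t. std_normal_density (exp (ln z / 2 + 1 / 2 * t)) * std_normal_density (z / exp (ln z / 2 + 1 / 2 * t)))
      = (\<lambda>t. 1 / (2 * pi) * exp (- z * cosh t))"
  proof
    fix t
    let ?x = "exp (ln z / 2 + 1 / 2 * t)"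
    \<comment> \<open>The squares of the two arguments are \<open>z * exp t\<close> and
      \<open>z * exp (- t)\<close>; half their sum is \<open>z * cosh t\<close>, the exponent in
      \<open>bessel_K0\<close>.\<close>
    have x2: "?x\<^sup>2 = z * exp t"
      unfolding exp_double[symmetric] using z by (simp add: distrib_left exp_add)
    have "(z / ?x)\<^sup>2 = z * exp (- t)"
      unfolding power_divide x2 using z by (simp add: power2_eq_square exp_minus field_simps)
    with x2 have "exp (- ?x\<^sup>2 / 2) * exp (- (z / ?x)\<^sup>2 / 2) = exp (- z * cosh t)"
      unfolding exp_add[symmetric] by (simp add: cosh_def field_simps)
    then show "std_normal_density ?x * std_normal_density (z / ?x) = 1 / (2 * pi) * exp (- z * cosh t)"
      by (simp add: std_normal_density_def field_simps)
  qed
  also have "(\<integral>\<^sup>+t. ennreal (1 / (2 * pi) * exp (- z * cosh t)) \<partial>lborel) = ennreal (1 / (2 * pi)) * (\<integral>\<^sup>+t. ?e t \<partial>lborel)"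
    by (subst nn_integral_cmult[symmetric]) (auto simp: ennreal_mult'[symmetric])
  also have "(\<integral>\<^sup>+t. ?e t \<partial>lborel) = 2 * (\<integral>\<^sup>+t. ?e t * indicator {0<..} t \<partial>lborel)"
    by (rule nn_integral_even) auto
  also have "(\<integral>\<^sup>+t. ?e t * indicator {0<..} t \<partial>lborel) = (\<integral>\<^sup>+t. ?e t * indicator {0..} t \<partial>lborel)"
    by (intro nn_integral_cong_AE eventually_mono[OF AE_lborel_singleton[of "0::real"]])
       (auto split: split_indicator)
  finally have "(\<integral>\<^sup>+x. ennreal (std_normal_density x * std_normal_density (z / x) / \<bar>x\<bar>) \<partial>lborel)
      = (2 * ennreal (1 / 2)) * (ennreal (1 / (2 * pi)) * 2) * (\<integral>\<^sup>+t. ?e t * indicator {0..} t \<partial>lborel)"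
    by (simp add: mult_ac)
  also have "ennreal (1 / (2 * pi)) * 2 = ennreal (1 / pi)"
    by (subst ennreal_numeral[symmetric], subst ennreal_mult'[symmetric]) auto
  also have "2 * ennreal (1 / 2) = 1"
    by (subst ennreal_numeral[symmetric], subst ennreal_mult'[symmetric]) auto
  finally show ?thesis by simp
qed

text \<open>For fixed \<open>x \<noteq> 0\<close> the change \<open>y = z / x\<close> has Jacobian
  \<open>1 / |x|\<close>; Tonelli then moves the integral over \<open>z\<close> outside. The inner
  integral on the right is the density of the product of two normals.\<close>

lemma nn_integral_normal_product:
  fixes g :: "real \<Rightarrow> ennreal"
  assumes [measurable]: "g \<in> borel_measurable borel"
  shows "(\<integral>\<^sup>+x. \<integral>\<^sup>+y. g (x * y) \<partial>std_normal_distribution \<partial>std_normal_distribution)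
       = (\<integral>\<^sup>+z. g z * (\<integral>\<^sup>+x. ennreal (std_normal_density x * std_normal_density (z / x) / \<bar>x\<bar>) \<partial>lborel) \<partial>lborel)"
proof -
  have inner: "ennreal (std_normal_density x) * (\<integral>\<^sup>+y. ennreal (std_normal_density y) * g (x * y) \<partial>lborel)
      = (\<integral>\<^sup>+z. g z * ennreal (std_normal_density x * std_normal_density (z / x) / \<bar>x\<bar>) \<partial>lborel)"
    if "x \<noteq> 0" for x
  proof -
    have "(\<integral>\<^sup>+y. ennreal (std_normal_density y) * g (x * y) \<partial>lborel)
        = ennreal \<bar>1 / x\<bar> * (\<integral>\<^sup>+z. ennreal (std_normal_density (z / x)) * g z \<partial>lborel)"
      using that by (subst nn_integral_real_affine[where c = "1 / x" and t = 0]) auto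
    then show ?thesis
      by (simp add: nn_integral_cmult[symmetric] ennreal_mult'[symmetric] mult_ac)
  qed
  have "(\<integral>\<^sup>+x. \<integral>\<^sup>+y. g (x * y) \<partial>std_normal_distribution \<partial>std_normal_distribution)
      = (\<integral>\<^sup>+x. ennreal (std_normal_density x) * (\<integral>\<^sup>+y. ennreal (std_normal_density y) * g (x * y) \<partial>lborel) \<partial>lborel)"
    by (simp add: nn_integral_density)
  also have "\<dots> = (\<integral>\<^sup>+x. \<integral>\<^sup>+z. g z * ennreal (std_normal_density x * std_normal_density (z / x) / \<bar>x\<bar>) \<partial>lborel \<partial>lborel)"
    by (intro nn_integral_cong_AE eventually_mono[OF AE_lborel_singleton[of "0::real"]] inner)
  also have "\<dots> = (\<integral>\<^sup>+z. \<integral>\<^sup>+x. g z * ennreal (std_normal_density x * std_normal_density (z / x) / \<bar>x\<bar>) \<partial>lborel \<partial>lborel)"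
    by (rule lborel_pair.Fubini') simp
  also have "\<dots> = (\<integral>\<^sup>+z. g z * (\<integral>\<^sup>+x. ennreal (std_normal_density x * std_normal_density (z / x) / \<bar>x\<bar>) \<partial>lborel) \<partial>lborel)"
    by (simp add: nn_integral_cmult)
  finally show ?thesis .
qed

text \<open>The product density \<open>q\<close> is even, so its formula for \<open>z > 0\<close>
  determines it off the null set \<open>{0}\<close>. Agreement of the densities almost everywhere is
  enough for equal measures.\<close>

lemma SVG_110_eq_distr:
  "SVG_110 = distr (std_normal_distribution \<Otimes>\<^sub>M std_normal_distribution) borel (\<lambda>(x, y). x * y)"
proof -
  let ?N = "std_normal_distribution"
  interpret N: prob_space ?N by (rule prob_space_normal_density) simp
  define q where "q = (\<lambda>z. \<integral>\<^sup>+x. ennreal (std_normal_density x * std_normal_density (z / x) / \<bar>x\<bar>) \<partial>lborel)"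
  have [measurable]: "q \<in> borel_measurable borel" unfolding q_def by measurable
  have "(\<integral>\<^sup>+z. q z \<partial>lborel) = (\<integral>\<^sup>+x. \<integral>\<^sup>+y. 1 \<partial>?N \<partial>?N)"
    unfolding q_def using nn_integral_normal_product[of "\<lambda>_. 1"] by simp
  then have "(\<integral>\<^sup>+z. q z \<partial>lborel) \<noteq> \<infinity>"
    by (simp add: N.emeasure_space_1[simplified])
  \<comment> \<open>Total mass 1 makes \<open>q\<close> finite almost everywhere. Finiteness matters
    since \<open>bessel_K0\<close> is a Bochner integral, with value 0 where the integral diverges,
    as it does at the origin.\<close>
  then have fin: "AE z in lborel. q z \<noteq> \<infinity>"
    by (intro nn_integral_noteq_infinite) auto
  have q_abs: "q \<bar>z\<bar> = q z" for z
    by (auto simp: q_def abs_if std_normal_density_def)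
  have dens: "AE z in lborel. ennreal (bessel_K0 \<bar>z\<bar> / pi) = q z"
    using fin AE_lborel_singleton[of "0::real"]
  proof eventually_elim
    case (elim z)
    let ?e = "\<lambda>t. exp (- \<bar>z\<bar> * cosh t)"
    define I where "I = (\<integral>\<^sup>+t. ennreal (?e t) * indicator {0..} t \<partial>lborel)"
    have q: "q z = ennreal (1 / pi) * I"
      using nn_integral_normal_product_density[of "\<bar>z\<bar>"] elim(2) q_abs[of z] by (simp add: q_def I_def)
    have "I \<noteq> \<infinity>"
      using elim(1) unfolding q by (auto simp: ennreal_mult_eq_top_iff)
    moreover have "bessel_K0 \<bar>z\<bar> = enn2real I"
      unfolding bessel_K0_def set_lebesgue_integral_def I_def
      by (subst integral_eq_nn_integral)
         (auto intro!: arg_cong[where f = enn2real] nn_integral_cong split: split_indicator)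
    ultimately show ?case
      unfolding q by (simp add: divide_inverse mult.commute ennreal_mult' less_top)
  qed
  show ?thesis
  proof (rule measure_eqI)
    fix A assume "A \<in> sets SVG_110"
    then have [measurable]: "A \<in> sets borel" by (simp add: SVG_110_def)
    have SVG_q: "SVG_110 = density lborel q"
    proof -
      have [measurable]: "(\<lambda>z. ennreal (bessel_K0 \<bar>z\<bar> / pi)) \<in> borel_measurable lborel"
        unfolding bessel_K0_def set_lebesgue_integral_def by measurable
      show ?thesis unfolding SVG_110_def by (intro density_cong dens) auto
    qed
    have "emeasure SVG_110 A = (\<integral>\<^sup>+z. q z * indicator A z \<partial>lborel)"
      unfolding SVG_q by (rule emeasure_density) auto
    also have "\<dots> = (\<integral>\<^sup>+z. indicator A z * q z \<partial>lborel)"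
      by (simp only: mult.commute)
    also have "\<dots> = (\<integral>\<^sup>+x. \<integral>\<^sup>+y. indicator A (x * y) \<partial>?N \<partial>?N)"
      unfolding q_def by (rule nn_integral_normal_product[symmetric]) simp
    also have "\<dots> = (\<integral>\<^sup>+p. indicator A (fst p * snd p) \<partial>(?N \<Otimes>\<^sub>M ?N))"
      by (subst N.nn_integral_fst[symmetric]) auto
    also have "\<dots> = (\<integral>\<^sup>+z. indicator A z \<partial>distr (?N \<Otimes>\<^sub>M ?N) borel (\<lambda>(x, y). x * y))"
      by (subst nn_integral_distr) (auto simp: case_prod_beta)
    finally show "emeasure SVG_110 A = emeasure (distr (?N \<Otimes>\<^sub>M ?N) borel (\<lambda>(x, y). x * y)) A"
      by simp
  qed (simp add: SVG_110_def)
qed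

lemma integral_SVG_110:
  fixes h :: "real \<Rightarrow> real"
  assumes [measurable]: "h \<in> borel_measurable borel"
    and int: "integrable (std_normal_distribution \<Otimes>\<^sub>M std_normal_distribution) (\<lambda>(x, y). h (x * y))"
  shows "integral\<^sup>L SVG_110 h = (\<integral>x. \<integral>y. h (x * y) \<partial>std_normal_distribution \<partial>std_normal_distribution)"
proof -
  interpret N: prob_space std_normal_distribution by (rule prob_space_normal_density) simp
  interpret pair_sigma_finite std_normal_distribution std_normal_distribution ..
  have "integral\<^sup>L SVG_110 h
      = (\<integral>p. (\<lambda>(x, y). h (x * y)) p \<partial>(std_normal_distribution \<Otimes>\<^sub>M std_normal_distribution))"
    unfolding SVG_110_eq_distr by (subst integral_distr) (auto simp: case_prod_beta')
  also have "\<dots> = (\<integral>x. \<integral>y. h (x * y) \<partial>std_normal_distribution \<partial>std_normal_distribution)"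
    using integral_fst'[OF int] by simp
  finally show ?thesis .
qed

section \<open>Gaussian tails and Stein's equation\<close>

text \<open>For \<open>K\<close> of mean 0, the function
  \<open>- normal_tail K x / std_normal_density x\<close> is the bounded Stein solution sought
  below; bounds on tails relative to the density therefore bound that solution.\<close>

definition normal_tail :: "(real \<Rightarrow> real) \<Rightarrow> real \<Rightarrow> real" where
  "normal_tail g x = (\<integral>t. indicator {x..} t * g t \<partial>std_normal_distribution)"

lemma prob_space_std_normal: "prob_space std_normal_distribution"
  by (rule prob_space_normal_density) simp

lemma integrable_std_normal_const [simp]: "integrable std_normal_distribution (\<lambda>_. c :: real)"
proof -
  interpret prob_space std_normal_distribution by (rule prob_space_std_normal)
  show ?thesis by simp
qed

lemma integrable_std_normal_id [simp]: "integrable std_normal_distribution (\<lambda>x. x)"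
  using integrable_std_normal_distribution_moment[of 1] by simp

lemma integrable_std_normal_square [simp]: "integrable std_normal_distribution (\<lambda>x. x\<^sup>2)"
  using integrable_std_normal_distribution_moment[of 2] by simp

lemma integral_std_normal_const [simp]: "(\<integral>x. c \<partial>std_normal_distribution) = (c :: real)"
proof -
  interpret prob_space std_normal_distribution by (rule prob_space_std_normal)
  show ?thesis using prob_space by simp
qed

lemma std_normal_abs_moment_le: "(\<integral>x. \<bar>x\<bar> \<partial>std_normal_distribution) \<le> 1"
proof -
  have "(\<integral>x. \<bar>x\<bar> \<partial>std_normal_distribution) = sqrt (2 / pi)"
    using std_normal_distribution_odd_moments_abs[of 0] by simp
  also have "\<dots> \<le> 1" using pi_ge_two by simp
  finally show ?thesis .
qed

lemma integral_std_normal_uminus: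
  fixes g :: "real \<Rightarrow> real"
  assumes [measurable]: "g \<in> borel_measurable borel"
  shows "(\<integral>x. g (- x) \<partial>std_normal_distribution) = (\<integral>x. g x \<partial>std_normal_distribution)"
proof -
  have "(\<integral>x. g x \<partial>std_normal_distribution) = (\<integral>x. std_normal_density x * g x \<partial>lborel)"
    by (subst integral_density) (auto simp: normal_density_nonneg)
  also have "\<dots> = (\<integral>x. std_normal_density (- x) * g (- x) \<partial>lborel)"
    by (subst lborel_integral_real_affine[where c = "-1" and t = 0]) auto
  also have "\<dots> = (\<integral>x. std_normal_density x * g (- x) \<partial>lborel)"
    by (simp add: std_normal_density_def)
  also have "\<dots> = (\<integral>x. g (- x) \<partial>std_normal_distribution)"
    by (subst integral_density) (auto simp: normal_density_nonneg)
  finally show ?thesis by simp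
qed

lemma integrable_indicator_mult:
  fixes g :: "'a \<Rightarrow> real"
  assumes "integrable M g" "A \<in> sets M"
  shows "integrable M (\<lambda>t. indicator A t * g t)"
  using integrable_mult_indicator[OF assms(2,1)] by simp

lemma AE_std_normal_neq: "AE t in std_normal_distribution. t \<noteq> x"
  by (subst AE_density) (auto intro: eventually_mono[OF AE_lborel_singleton[of x]])

text \<open>The fundamental theorem of calculus, phrased as constancy of
  \<open>normal_tail g + G\<close>. It serves twice: to evaluate tails with an explicit
  antiderivative vanishing at infinity, and to differentiate tails with an abstract one.\<close>

lemma normal_tail_diff:
  assumes "continuous_on UNIV g" and int: "integrable std_normal_distribution g"
    and G: "\<And>t. (G has_real_derivative std_normal_density t * g t) (at t)"
  shows "normal_tail g x + G x = normal_tail g y + G y"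
proof -
  have *: "normal_tail g x - normal_tail g y = G y - G x" if "x \<le> y" for x y
  proof -
    have [measurable]: "g \<in> borel_measurable borel"
      by (rule borel_measurable_continuous_onI) fact
    have "normal_tail g x - normal_tail g y
        = (\<integral>t. indicator {x..} t * g t - indicator {y..} t * g t \<partial>std_normal_distribution)"
      unfolding normal_tail_def
      by (rule Bochner_Integration.integral_diff[symmetric]) (auto intro!: integrable_indicator_mult int)
    also have "\<dots> = (\<integral>t. indicator {x..y} t * g t \<partial>std_normal_distribution)"
      by (intro integral_cong_AE eventually_mono[OF AE_std_normal_neq[of y]])
         (use that in \<open>auto split: split_indicator\<close>)
    also have "\<dots> = (\<integral>t. indicator {x..y} t *\<^sub>R (std_normal_density t * g t) \<partial>lborel)"
      by (subst integral_density) (auto simp: normal_density_nonneg mult_ac)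
    also have "\<dots> = G y - G x"
    proof (rule integral_FTC_atLeastAtMost[OF that])
      show "(G has_vector_derivative std_normal_density t * g t) (at t within {x..y})" for t
        using G[of t] by (auto simp: has_real_derivative_iff_has_vector_derivative
            intro: has_vector_derivative_at_within)
      show "continuous_on {x..y} (\<lambda>t. std_normal_density t * g t)"
        unfolding std_normal_density_def
        by (intro continuous_intros continuous_on_subset[OF assms(1)]) auto
    qed
    finally show ?thesis .
  qed
  show ?thesis using *[of x y] *[of y x] by (cases "x \<le> y") auto
qed

lemma normal_tail_tendsto_0:
  assumes "integrable std_normal_distribution g"
  shows "(normal_tail g \<longlongrightarrow> 0) at_top"
proof -
  have "((\<lambda>x. \<integral>t. indicator {x..} t * g t \<partial>std_normal_distribution)
      \<longlongrightarrow> (\<integral>t. 0 \<partial>std_normal_distribution)) at_top"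
  proof (rule integral_dominated_convergence_at_top[where w = "\<lambda>t. \<bar>g t\<bar>"])
    have "((\<lambda>x. indicator {x..} t * g t) \<longlongrightarrow> 0) at_top" for t
      by (rule tendsto_eventually) (auto intro!: eventually_mono[OF eventually_gt_at_top[of t]])
    then show "AE t in std_normal_distribution. ((\<lambda>x. indicator {x..} t * g t) \<longlongrightarrow> 0) at_top"
      by simp
  qed (use assms in \<open>auto intro!: always_eventually split: split_indicator\<close>)
  then show ?thesis unfolding normal_tail_def by simp
qed

lemma normal_tail_FTC:
  assumes "continuous_on UNIV g" "integrable std_normal_distribution g"
    and "\<And>t. (G has_real_derivative std_normal_density t * g t) (at t)"
    and lim: "(G \<longlongrightarrow> 0) at_top"
  shows "normal_tail g x = - G x"
proof -
  have "((\<lambda>y. normal_tail g y + G y) \<longlongrightarrow> 0 + 0) at_top"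
    by (intro tendsto_add normal_tail_tendsto_0 assms lim)
  moreover have "(\<lambda>y. normal_tail g y + G y) = (\<lambda>y. normal_tail g x + G x)"
    using normal_tail_diff[OF assms(1-3)] by blast
  ultimately have "normal_tail g x + G x = 0"
    by (simp add: tendsto_const_iff)
  then show ?thesis by simp
qed

lemma normal_tail_has_derivative:
  assumes "continuous_on UNIV g" "integrable std_normal_distribution g"
  shows "(normal_tail g has_real_derivative - (std_normal_density x * g x)) (at x)"
proof -
  have "isCont (\<lambda>t. std_normal_density t * g t) t" for t
    unfolding std_normal_density_def
    using assms(1) by (intro continuous_intros) (auto simp: continuous_on_eq_continuous_at)
  then obtain G where G: "\<And>t. (G has_vector_derivative std_normal_density t * g t) (at t)"
    using einterval_antiderivative[of "-\<infinity>" "\<infinity>" "\<lambda>t. std_normal_density t * g t"] by auto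
  then have G': "\<And>t. (G has_real_derivative std_normal_density t * g t) (at t)"
    by (simp add: has_real_derivative_iff_has_vector_derivative)
  have "normal_tail g y = (normal_tail g 0 + G 0) - G y" for y
    using normal_tail_diff[OF assms G', of y 0] by simp
  then have "normal_tail g = (\<lambda>y. (normal_tail g 0 + G 0) - G y)" by blast
  then show ?thesis
    by (rule ssubst) (auto intro!: derivative_eq_intros G')
qed

lemma std_normal_density_has_derivative:
  "(std_normal_density has_real_derivative - (x * std_normal_density x)) (at x)"
  unfolding std_normal_density_def
  by (rule derivative_eq_intros refl | simp)+

lemma normal_tail_add:
  assumes "integrable std_normal_distribution f" "integrable std_normal_distribution g"
  shows "normal_tail (\<lambda>t. f t + g t) x = normal_tail f x + normal_tail g x"
  unfolding normal_tail_def distrib_left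
  by (intro Bochner_Integration.integral_add integrable_indicator_mult assms) auto

lemma normal_tail_cmult: "normal_tail (\<lambda>t. c * g t) x = c * normal_tail g x"
  unfolding normal_tail_def by (simp add: mult.left_commute)

lemma normal_tail_mono:
  assumes "integrable std_normal_distribution f" "integrable std_normal_distribution g"
    and "\<And>t. t \<ge> x \<Longrightarrow> f t \<le> g t"
  shows "normal_tail f x \<le> normal_tail g x"
  unfolding normal_tail_def
  by (intro integral_mono integrable_indicator_mult assms) (auto split: split_indicator intro: assms)

lemma normal_tail_abs_le:
  assumes "integrable std_normal_distribution f" "integrable std_normal_distribution g"
    and "\<And>t. t \<ge> x \<Longrightarrow> \<bar>f t\<bar> \<le> g t"
  shows "\<bar>normal_tail f x\<bar> \<le> normal_tail g x"
proof -
  have "normal_tail f x \<le> normal_tail g x"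
    using assms(3) by (intro normal_tail_mono assms) (auto dest: abs_le_D1)
  moreover have "normal_tail (\<lambda>t. - 1 * f t) x \<le> normal_tail g x"
    using assms(3) by (intro normal_tail_mono) (use assms in \<open>auto dest: abs_le_D2\<close>)
  ultimately show ?thesis unfolding normal_tail_cmult by auto
qed

section \<open>Explicit Gaussian tails and Mills ratio bounds\<close>

lemma normal_tail_id: "normal_tail (\<lambda>t. t) x = std_normal_density x"
proof -
  have "normal_tail (\<lambda>t. t) x = - (- std_normal_density x)"
  proof (rule normal_tail_FTC[where G = "\<lambda>t. - std_normal_density t"])
    show "((\<lambda>t. - std_normal_density t) \<longlongrightarrow> 0) at_top"
      unfolding std_normal_density_def by real_asymp
  qed (auto intro!: derivative_eq_intros std_normal_density_has_derivative continuous_intros)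
  then show ?thesis by simp
qed

lemma normal_tail_square:
  "normal_tail (\<lambda>t. t\<^sup>2) x = x * std_normal_density x + normal_tail (\<lambda>_. 1) x"
proof -
  \<comment> \<open>The antiderivative of \<open>t^2 - 1\<close> against the density is
    \<open>- t\<close> times the density, which vanishes at infinity.\<close>
  have "normal_tail (\<lambda>t. t\<^sup>2 + - 1 * 1) x = - (- (x * std_normal_density x))"
  proof (rule normal_tail_FTC[where G = "\<lambda>t. - (t * std_normal_density t)"])
    show "((\<lambda>t. - (t * std_normal_density t)) \<longlongrightarrow> 0) at_top"
      unfolding std_normal_density_def by real_asymp
    show "((\<lambda>t. - (t * std_normal_density t)) has_real_derivative std_normal_density t * (t\<^sup>2 + - 1 * 1)) (at t)" for t
      by (rule derivative_eq_intros std_normal_density_has_derivative refl)+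
         (simp add: algebra_simps power2_eq_square)
  qed (auto intro!: continuous_intros)
  then show ?thesis
    using normal_tail_add[of "\<lambda>t. t\<^sup>2" "\<lambda>t. - 1 * 1" x] normal_tail_cmult[of "-1" "\<lambda>_. 1" x] by simp
qed

lemma std_normal_density_antimono:
  assumes "0 \<le> x" "x \<le> y" shows "std_normal_density y \<le> std_normal_density x"
  using assms unfolding std_normal_density_def
  by (intro mult_left_mono) (auto intro!: power_mono divide_right_mono)

lemma normal_tail_one_nonneg: "normal_tail (\<lambda>_. 1) x \<ge> 0"
  unfolding normal_tail_def by simp

text \<open>The upper Mills bound: replace \<open>x\<close> by the larger \<open>t\<close> under the
  tail integral.\<close>

lemma normal_tail_one_mult_le: "x * normal_tail (\<lambda>_. 1) x \<le> std_normal_density x"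
proof -
  have "normal_tail (\<lambda>t. x * 1) x \<le> normal_tail (\<lambda>t. t) x"
    by (rule normal_tail_mono) auto
  then show ?thesis unfolding normal_tail_cmult normal_tail_id .
qed

text \<open>Expand \<open>normal_tail (\<lambda>t. (t - x)\<^sup>2) x \<ge> 0\<close>.\<close>

lemma normal_tail_one_ge: "x * std_normal_density x \<le> (1 + x\<^sup>2) * normal_tail (\<lambda>_. 1) x"
proof -
  have "0 \<le> normal_tail (\<lambda>t. (t - x)\<^sup>2) x"
    unfolding normal_tail_def by simp
  also have "(\<lambda>t. (t - x)\<^sup>2) = (\<lambda>t. t\<^sup>2 + ((- 2 * x) * t + x\<^sup>2 * 1))"
    by (auto simp: power2_eq_square algebra_simps)
  also have "normal_tail \<dots> x
      = normal_tail (\<lambda>t. t\<^sup>2) x + (normal_tail (\<lambda>t. (- 2 * x) * t) x + normal_tail (\<lambda>t. x\<^sup>2 * 1) x)"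
    by (subst normal_tail_add, (simp; fail), (simp; fail), subst normal_tail_add) auto
  finally show ?thesis
    unfolding normal_tail_cmult normal_tail_square normal_tail_id by (simp add: algebra_simps)
qed

text \<open>The upper Mills bound is weak near 0, so it is used at \<open>x + 1\<close>, where its
  factor is at least 1. The mass between \<open>x\<close> and \<open>x + 1\<close> is at most the
  density at \<open>x\<close>; the two pieces give the constant 2.\<close>

lemma normal_tail_one_le:
  assumes x: "x \<ge> 0"
  shows "normal_tail (\<lambda>_. 1) x \<le> 2 * std_normal_density x"
proof -
  have "\<exists>z>x. z < x + 1 \<and> normal_tail (\<lambda>_. 1) (x + 1) - normal_tail (\<lambda>_. 1) x
      = (x + 1 - x) * - (std_normal_density z * 1)"
    by (rule MVT2) (auto intro: normal_tail_has_derivative[of "\<lambda>_. 1", simplified])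
  then obtain z where "z > x"
    and z: "normal_tail (\<lambda>_. 1) x = normal_tail (\<lambda>_. 1) (x + 1) + std_normal_density z"
    by auto
  have "1 * normal_tail (\<lambda>_. 1) (x + 1) \<le> (x + 1) * normal_tail (\<lambda>_. 1) (x + 1)"
    using x by (intro mult_right_mono normal_tail_one_nonneg) auto
  also have "\<dots> \<le> std_normal_density (x + 1)"
    by (rule normal_tail_one_mult_le)
  finally show ?thesis
    using z std_normal_density_antimono[of x z] std_normal_density_antimono[of x "x + 1"] x \<open>z > x\<close>
    by simp
qed

section \<open>Bounds for the Stein solution and its derivative\<close>

text \<open>Divided by the density, the two quantities are \<open>|f x|\<close> and
  \<open>|f' x|\<close> for the Stein solution \<open>f\<close>. Both follow from the tail of the
  constant 1: once from \<open>normal_tail_one_le\<close>, once from the upper Mills bound plus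
  \<open>|K x| <= 1\<close>.\<close>

lemma normal_tail_bounds_bounded:
  assumes K: "integrable std_normal_distribution K" "\<And>t. \<bar>K t\<bar> \<le> 1" and x: "x \<ge> 0"
  shows "\<bar>normal_tail K x\<bar> \<le> 2 * std_normal_density x"
    and "\<bar>K x * std_normal_density x - x * normal_tail K x\<bar> \<le> 2 * std_normal_density x"
proof -
  have tail: "\<bar>normal_tail K x\<bar> \<le> normal_tail (\<lambda>_. 1) x"
    by (intro normal_tail_abs_le K) auto
  then show "\<bar>normal_tail K x\<bar> \<le> 2 * std_normal_density x"
    using normal_tail_one_le[OF x] by linarith
  have "\<bar>x * normal_tail K x\<bar> \<le> x * normal_tail (\<lambda>_. 1) x"
    using mult_left_mono[OF tail x] x by (simp add: abs_mult)
  then have "\<bar>x * normal_tail K x\<bar> \<le> std_normal_density x"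
    using normal_tail_one_mult_le[of x] by linarith
  moreover have "\<bar>K x * std_normal_density x\<bar> \<le> 1 * std_normal_density x"
    using K(2)[of x] by (simp add: abs_mult mult_right_mono normal_density_nonneg mult_left_le_one_le)
  ultimately show "\<bar>K x * std_normal_density x - x * normal_tail K x\<bar> \<le> 2 * std_normal_density x"
    by linarith
qed

text \<open>Here \<open>K\<close> may grow linearly, so the derivative bound needs a cancellation:
  on the tail, \<open>K\<close> is compared with its value at \<open>x\<close>, and the lower Mills
  bound makes the remainder decay quadratically relative to the density.\<close>

lemma normal_tail_bounds_lipschitz:
  assumes int: "integrable std_normal_distribution K"
    and lip: "\<And>s t. \<bar>K s - K t\<bar> \<le> \<bar>s - t\<bar>"
    and growth: "\<And>t. \<bar>K t\<bar> \<le> 1 + \<bar>t\<bar>" and x: "x \<ge> 0"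
  shows "\<bar>normal_tail K x\<bar> \<le> 3 * std_normal_density x"
    and "\<bar>K x * std_normal_density x - x * normal_tail K x\<bar> \<le> 2 * std_normal_density x"
proof -
  define p Q where "p = std_normal_density x" and "Q = normal_tail (\<lambda>_. 1) x"
  have "\<bar>normal_tail K x\<bar> \<le> normal_tail (\<lambda>t. 1 + t) x"
    using growth x by (intro normal_tail_abs_le int) (auto, metis abs_of_nonneg order_trans)
  also have "\<dots> = Q + p"
    by (subst normal_tail_add) (auto simp: Q_def p_def normal_tail_id)
  finally show "\<bar>normal_tail K x\<bar> \<le> 3 * std_normal_density x"
    using normal_tail_one_le[OF x] by (simp add: Q_def p_def)
  \<comment> \<open>The tail integral of \<open>t - x\<close>; by the Lipschitz condition it
    dominates the error of freezing \<open>K\<close> at \<open>x\<close>.\<close>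
  define D where "D = p - x * Q"
  have "normal_tail (\<lambda>t. t + (- x) * 1) x = D"
    by (subst normal_tail_add)
       (auto simp: normal_tail_cmult[of "- x" "\<lambda>_. 1", simplified] normal_tail_id D_def p_def Q_def)
  moreover have "\<bar>normal_tail (\<lambda>t. K t + (- K x) * 1) x\<bar> \<le> normal_tail (\<lambda>t. t + (- x) * 1) x"
    using lip[of _ x] by (intro normal_tail_abs_le) (auto intro!: int, metis abs_of_nonneg diff_ge_0_iff_ge)
  moreover have "normal_tail (\<lambda>t. K t + (- K x) * 1) x = normal_tail K x - K x * Q"
    by (subst normal_tail_add) (auto simp: int normal_tail_cmult[of "- K x" "\<lambda>_. 1", simplified] Q_def)
  ultimately have diff: "\<bar>normal_tail K x - K x * Q\<bar> \<le> D" by simp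
  \<comment> \<open>The lower Mills bound \<open>normal_tail_one_ge\<close> gives
    \<open>D <= p / (1 + x^2)\<close>.\<close>
  have "D * (1 + x\<^sup>2) = p * (1 + x\<^sup>2) - x * ((1 + x\<^sup>2) * Q)"
    by (simp add: D_def algebra_simps)
  also have "\<dots> \<le> p * (1 + x\<^sup>2) - x * (x * p)"
    using mult_left_mono[OF normal_tail_one_ge[of x] x] by (simp add: p_def Q_def)
  also have "\<dots> = p" by (simp add: algebra_simps power2_eq_square)
  finally have D: "D * (1 + x\<^sup>2) \<le> p" .
  have D0: "D \<ge> 0" using diff by linarith
  have "K x * p - x * normal_tail K x = K x * D - x * (normal_tail K x - K x * Q)"
    by (simp add: D_def algebra_simps)
  also have "\<bar>\<dots>\<bar> \<le> \<bar>K x\<bar> * D + x * \<bar>normal_tail K x - K x * Q\<bar>"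
    using x D0 by (metis abs_mult abs_of_nonneg abs_triangle_ineq4)
  also have "\<dots> \<le> (1 + x) * D + x * D"
    using growth[of x] x D0 diff by (intro add_mono mult_right_mono mult_left_mono) auto
  also have "\<dots> = (1 + 2 * x) * D" by (simp add: algebra_simps)
  \<comment> \<open>This is \<open>1 + 2 * x <= 2 * (1 + x^2)\<close>, equivalent to
    \<open>0 <= (x - 1)^2 + x^2\<close>.\<close>
  also have "\<dots> \<le> 2 * (1 + x\<^sup>2) * D"
    using sum_squares_ge_zero[of "x - 1" x]
    by (intro mult_right_mono D0) (simp add: power2_eq_square algebra_simps)
  also have "\<dots> \<le> 2 * p" using D by (simp add: algebra_simps)
  finally show "\<bar>K x * std_normal_density x - x * normal_tail K x\<bar> \<le> 2 * std_normal_density x"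
    by (simp add: p_def)
qed

text \<open>The tail of the reflected function is the lower tail of \<open>K\<close>, which is minus
  the upper tail because the mean is 0. Estimates on \<open>x >= 0\<close> thus transfer to negative
  arguments.\<close>

lemma normal_tail_uminus:
  assumes [measurable]: "K \<in> borel_measurable borel" and int: "integrable std_normal_distribution K"
    and zero: "(\<integral>t. K t \<partial>std_normal_distribution) = 0"
  shows "normal_tail (\<lambda>t. K (- t)) (- x) = - normal_tail K x"
proof -
  have "normal_tail (\<lambda>t. K (- t)) (- x)
      = (\<integral>t. (\<lambda>t. indicator {..x} t * K t) (- t) \<partial>std_normal_distribution)"
    unfolding normal_tail_def by (intro Bochner_Integration.integral_cong) (auto split: split_indicator)
  also have "\<dots> = (\<integral>t. indicator {..x} t * K t \<partial>std_normal_distribution)"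
    by (rule integral_std_normal_uminus) simp
  also have "\<dots> = (\<integral>t. K t - indicator {x..} t * K t \<partial>std_normal_distribution)"
    by (intro integral_cong_AE eventually_mono[OF AE_std_normal_neq[of x]])
       (auto split: split_indicator)
  also have "\<dots> = - normal_tail K x"
    unfolding normal_tail_def using zero
    by (subst Bochner_Integration.integral_diff) (auto intro!: integrable_indicator_mult int)
  finally show ?thesis .
qed

text \<open>The quotient rule shows that \<open>- normal_tail K / std_normal_density\<close> solves
  the equation. The hypotheses \<open>pos\<close> and \<open>neg\<close> are its bounds multiplied
  by the density, with \<open>neg\<close> covering negative arguments by reflection.\<close>

lemma stein_solution:
  fixes h :: "real \<Rightarrow> real"
  defines "K \<equiv> \<lambda>t. h t - (\<integral>s. h s \<partial>std_normal_distribution)"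
  assumes cont: "continuous_on UNIV h" and int: "integrable std_normal_distribution h"
    and pos: "\<And>x. x \<ge> 0 \<Longrightarrow> \<bar>normal_tail K x\<bar> \<le> A * std_normal_density x"
      "\<And>x. x \<ge> 0 \<Longrightarrow> \<bar>K x * std_normal_density x - x * normal_tail K x\<bar> \<le> B * std_normal_density x"
    and neg: "\<And>x. x \<ge> 0 \<Longrightarrow> \<bar>normal_tail (\<lambda>t. K (- t)) x\<bar> \<le> A * std_normal_density x"
      "\<And>x. x \<ge> 0 \<Longrightarrow> \<bar>K (- x) * std_normal_density x - x * normal_tail (\<lambda>t. K (- t)) x\<bar>
        \<le> B * std_normal_density x"
  obtains f where "\<And>x. (f has_real_derivative x * f x + K x) (at x)"
    "\<And>x. \<bar>f x\<bar> \<le> A" "\<And>x. \<bar>x * f x + K x\<bar> \<le> B"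
proof
  define f where "f = (\<lambda>x. - normal_tail K x / std_normal_density x)"
  have p: "std_normal_density x > 0" for x by (simp add: normal_density_pos)
  have K_cont: "continuous_on UNIV K" unfolding K_def by (intro continuous_intros cont)
  then have [measurable]: "K \<in> borel_measurable borel" by (rule borel_measurable_continuous_onI)
  have K_int: "integrable std_normal_distribution K" unfolding K_def using int by simp
  have K_zero: "(\<integral>t. K t \<partial>std_normal_distribution) = 0"
    unfolding K_def using int
    by (subst Bochner_Integration.integral_diff) (auto simp only: integral_std_normal_const integrable_std_normal_const)
  show "(f has_real_derivative x * f x + K x) (at x)" for x
    unfolding f_def
    by (rule derivative_eq_intros normal_tail_has_derivative[OF K_cont K_int]
          std_normal_density_has_derivative refl)+
       (use p[of x] in \<open>auto simp: field_simps\<close>)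
  have fp: "f x * std_normal_density x = - normal_tail K x" for x
    using p[of x] by (simp add: f_def)
  have "\<bar>normal_tail K x\<bar> \<le> A * std_normal_density x
      \<and> \<bar>K x * std_normal_density x - x * normal_tail K x\<bar> \<le> B * std_normal_density x" for x
  proof (cases "x \<ge> 0")
    case False
    then have "- x \<ge> 0" by simp
    moreover have "std_normal_density (- x) = std_normal_density x" by (simp add: std_normal_density_def)
    ultimately show ?thesis
      using neg[of "- x"] normal_tail_uminus[OF _ K_int K_zero, of x] by simp
  qed (use pos in auto)
  then have "\<bar>f x * std_normal_density x\<bar> \<le> A * std_normal_density x
      \<and> \<bar>(x * f x + K x) * std_normal_density x\<bar> \<le> B * std_normal_density x" for x
    by (simp add: distrib_right mult.assoc fp)
  then have "\<bar>f x\<bar> \<le> A \<and> \<bar>x * f x + K x\<bar> \<le> B" for x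
    using p[of x] unfolding abs_mult by (metis abs_of_pos mult_le_cancel_right_pos)
  then show "\<bar>f x\<bar> \<le> A" "\<bar>x * f x + K x\<bar> \<le> B" for x by blast+
qed

section \<open>Comparison with the normal distribution\<close>

text \<open>Together with its lower counterpart, this moves an estimate from the intermediate points
  of the cells to the nodes; since the weights sum to 1, the cellwise error is paid once.\<close>

lemma binomial_mean_le_sum:
  assumes "\<And>j. (g (binomial_node (Suc k) j) + g (binomial_node (Suc k) (Suc j))) / 2 \<le> v j + e"
  shows "binomial_mean (Suc k) g \<le> (\<Sum>j\<le>k. real (k choose j) / 2 ^ k * v j) + e"
proof -
  have "binomial_mean (Suc k) g \<le> (\<Sum>j\<le>k. real (k choose j) / 2 ^ k * (v j + e))"
    unfolding binomial_mean_pascal by (intro sum_mono mult_left_mono assms) simp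
  also have "\<dots> = (\<Sum>j\<le>k. real (k choose j) / 2 ^ k * v j) + e"
    unfolding distrib_left sum.distrib sum_distrib_right[symmetric] binomial_half_weights_sum by simp
  finally show ?thesis .
qed

lemma binomial_mean_ge_sum:
  assumes "\<And>j. v j - e \<le> (g (binomial_node (Suc k) j) + g (binomial_node (Suc k) (Suc j))) / 2"
  shows "(\<Sum>j\<le>k. real (k choose j) / 2 ^ k * v j) - e \<le> binomial_mean (Suc k) g"
proof -
  have "(\<Sum>j\<le>k. real (k choose j) / 2 ^ k * v j) - e = (\<Sum>j\<le>k. real (k choose j) / 2 ^ k * (v j - e))"
    unfolding right_diff_distrib sum_subtractf sum_distrib_right[symmetric] binomial_half_weights_sum by simp
  also have "\<dots> \<le> binomial_mean (Suc k) g"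
    unfolding binomial_mean_pascal by (intro sum_mono mult_left_mono assms) simp
  finally show ?thesis .
qed

lemma integrable_std_normal_lipschitz:
  fixes h :: "real \<Rightarrow> real"
  assumes [measurable]: "h \<in> borel_measurable borel" and lip: "\<And>s t. \<bar>h s - h t\<bar> \<le> \<bar>s - t\<bar>"
  shows "integrable std_normal_distribution h"
proof (rule Bochner_Integration.integrable_bound)
  show "integrable std_normal_distribution (\<lambda>t. \<bar>h 0\<bar> + \<bar>t\<bar>)"
    by simp
  have "\<bar>h t\<bar> \<le> \<bar>h 0\<bar> + \<bar>t\<bar>" for t
    using lip[of t 0] by simp
  then show "AE t in std_normal_distribution. norm (h t) \<le> norm (\<bar>h 0\<bar> + \<bar>t\<bar>)"
    by simp
qed simp

lemma real_lipschitz_continuous: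
  fixes h :: "real \<Rightarrow> real"
  assumes "\<And>s t. \<bar>h s - h t\<bar> \<le> \<bar>s - t\<bar>"
  shows "continuous_on UNIV h"
proof -
  have "1-lipschitz_on UNIV h"
    by (rule lipschitz_onI) (use assms in \<open>auto simp: dist_real_def\<close>)
  then show ?thesis by (rule lipschitz_on_continuous_on)
qed

text \<open>The Stein bounds 3 and 2 cost five spacings \<open>2 / sqrt m\<close>; moving
  \<open>h\<close> from the points \<open>u j\<close> to the nodes costs one more, giving
  12.\<close>

lemma binomial_normal_lipschitz:
  fixes h :: "real \<Rightarrow> real"
  assumes m: "m \<ge> 1" and lip: "\<And>s t. \<bar>h s - h t\<bar> \<le> \<bar>s - t\<bar>"
  shows "\<bar>binomial_mean m h - (\<integral>x. h x \<partial>std_normal_distribution)\<bar> \<le> 12 / sqrt (real m)"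
proof -
  obtain k where k: "m = Suc k" using m by (cases m) auto
  define c where "c = (\<integral>x. h x \<partial>std_normal_distribution)"
  have cont: "continuous_on UNIV h" by (rule real_lipschitz_continuous[OF lip])
  then have [measurable]: "h \<in> borel_measurable borel" by (rule borel_measurable_continuous_onI)
  have int: "integrable std_normal_distribution h" by (rule integrable_std_normal_lipschitz[OF _ lip]) simp
  \<comment> \<open>Average the Lipschitz estimate over an independent normal \<open>s\<close>,
    whose first absolute moment is at most 1.\<close>
  have growth: "\<bar>h t - c\<bar> \<le> 1 + \<bar>t\<bar>" for t
  proof -
    have "h t - c = (\<integral>s. h t - h s \<partial>std_normal_distribution)"
      unfolding c_def using int
      by (subst Bochner_Integration.integral_diff) (auto simp only: integral_std_normal_const integrable_std_normal_const)
    also have "\<bar>\<dots>\<bar> \<le> (\<integral>s. \<bar>h t - h s\<bar> \<partial>std_normal_distribution)"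
      by (rule integral_abs_bound)
    also have "\<dots> \<le> (\<integral>s. \<bar>t\<bar> + \<bar>s\<bar> \<partial>std_normal_distribution)"
    proof (rule integral_mono)
      show "\<bar>h t - h s\<bar> \<le> \<bar>t\<bar> + \<bar>s\<bar>" for s using lip[of t s] by linarith
    qed (use int in auto)
    also have "\<dots> = \<bar>t\<bar> + (\<integral>s. \<bar>s\<bar> \<partial>std_normal_distribution)"
      by (subst Bochner_Integration.integral_add) (auto simp only: integral_std_normal_const integrable_std_normal_const integrable_std_normal_id integrable_abs)
    finally show ?thesis using std_normal_abs_moment_le by linarith
  qed
  have growth': "\<bar>h (- t) - c\<bar> \<le> 1 + \<bar>t\<bar>" for t using growth[of "- t"] by simp
  have lip': "\<bar>h (- s) - h (- t)\<bar> \<le> \<bar>s - t\<bar>" for s t using lip[of "- s" "- t"] by simp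
  have int': "integrable std_normal_distribution (\<lambda>t. h (- t))"
    by (rule integrable_std_normal_lipschitz[OF _ lip']) simp
  have pos: "\<bar>normal_tail (\<lambda>t. h t - c) x\<bar> \<le> 3 * std_normal_density x"
    "\<bar>(h x - c) * std_normal_density x - x * normal_tail (\<lambda>t. h t - c) x\<bar> \<le> 2 * std_normal_density x"
    if "x \<ge> 0" for x
    by (rule normal_tail_bounds_lipschitz; use that int lip growth in auto)+
  have neg: "\<bar>normal_tail (\<lambda>t. h (- t) - c) x\<bar> \<le> 3 * std_normal_density x"
    "\<bar>(h (- x) - c) * std_normal_density x - x * normal_tail (\<lambda>t. h (- t) - c) x\<bar> \<le> 2 * std_normal_density x"
    if "x \<ge> 0" for x
    by (rule normal_tail_bounds_lipschitz[where K = "\<lambda>t. h (- t) - c"]; use that int' lip' growth' in auto)+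
  obtain f where "\<And>x. (f has_real_derivative x * f x + (h x - c)) (at x)"
    "\<And>x. \<bar>f x\<bar> \<le> 3" "\<And>x. \<bar>x * f x + (h x - c)\<bar> \<le> 2"
    by (rule stein_solution[of h 3 2, OF cont int, folded c_def]) (erule pos neg | rule that | assumption)+
  then obtain u where u: "\<And>j. binomial_node (Suc k) j \<le> u j \<and> u j \<le> binomial_node (Suc k) (Suc j)"
    and est: "\<bar>(\<Sum>j\<le>k. real (k choose j) / 2 ^ k * h (u j)) - c\<bar> \<le> 2 / sqrt (real (Suc k)) * (3 + 2)"
    by (rule binomial_stein_comparison[where k = k]) (rule that)
  define d where "d = 2 / sqrt (real (Suc k))"
  have "\<bar>(h (binomial_node (Suc k) j) + h (binomial_node (Suc k) (Suc j))) / 2 - h (u j)\<bar> \<le> d" for j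
  proof -
    have "\<bar>h (binomial_node (Suc k) j) - h (u j)\<bar> \<le> d" "\<bar>h (binomial_node (Suc k) (Suc j)) - h (u j)\<bar> \<le> d"
      using lip[of "binomial_node (Suc k) j" "u j"] lip[of "binomial_node (Suc k) (Suc j)" "u j"]
        u[of j] binomial_node_Suc[of "Suc k" j] by (auto simp: d_def)
    then show ?thesis by argo
  qed
  then have *: "h (u j) - d \<le> (h (binomial_node (Suc k) j) + h (binomial_node (Suc k) (Suc j))) / 2"
    "(h (binomial_node (Suc k) j) + h (binomial_node (Suc k) (Suc j))) / 2 \<le> h (u j) + d" for j
    by (simp_all add: abs_diff_le_iff)
  define s where "s = (\<Sum>j\<le>k. real (k choose j) / 2 ^ k * h (u j))"
  have "\<bar>s - c\<bar> \<le> d * 5" "binomial_mean (Suc k) h \<le> s + d" "s - d \<le> binomial_mean (Suc k) h"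
    using binomial_mean_le_sum[OF *(2)] binomial_mean_ge_sum[OF *(1)] est by (simp_all add: d_def s_def)
  then have "\<bar>binomial_mean (Suc k) h - c\<bar> \<le> d * 5 + d" by linarith
  then show ?thesis unfolding k c_def d_def by simp
qed

section \<open>Half-lines, approximated by ramps\<close>

lemma normal_tail_one_increment:
  assumes "x \<le> y"
  shows "normal_tail (\<lambda>_. 1) x \<le> normal_tail (\<lambda>_. 1) y + (y - x) / 2"
proof (cases "x = y")
  case False
  then have "x < y" using assms by simp
  then have "\<exists>z>x. z < y \<and> normal_tail (\<lambda>_. 1) y - normal_tail (\<lambda>_. 1) x = (y - x) * - (std_normal_density z * 1)"
    by (intro MVT2) (auto intro: normal_tail_has_derivative[of "\<lambda>_. 1", simplified])
  then obtain z where z: "normal_tail (\<lambda>_. 1) y - normal_tail (\<lambda>_. 1) x = - ((y - x) * std_normal_density z)"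
    by auto
  \<comment> \<open>The density never exceeds \<open>1 / sqrt (2 * pi)\<close>, which is at most
    \<open>1 / 2\<close> because \<open>pi >= 2\<close>.\<close>
  have "sqrt 4 \<le> sqrt (2 * pi)" using pi_ge_two by (intro real_sqrt_le_mono) simp
  then have "1 / sqrt (2 * pi) \<le> 1 / 2" by (intro divide_left_mono) auto
  moreover have "exp (- z\<^sup>2 / 2) \<le> 1" by simp
  ultimately have "std_normal_density z \<le> 1 / 2 * 1"
    unfolding std_normal_density_def by (intro mult_mono) auto
  then have "(y - x) * std_normal_density z \<le> (y - x) * (1 / 2)"
    using \<open>x < y\<close> by (intro mult_left_mono) auto
  then show ?thesis using z by argo
qed simp

lemma integral_std_normal_one_minus_indicator:
  "(\<integral>t. 1 - indicator {x..} t \<partial>std_normal_distribution) = 1 - normal_tail (\<lambda>_. 1) x"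
proof -
  have "integrable std_normal_distribution (\<lambda>t. indicator {x..} t * 1 :: real)"
    by (rule integrable_indicator_mult) auto
  then have "(\<integral>t. 1 - indicator {x..} t * 1 \<partial>std_normal_distribution) = 1 - normal_tail (\<lambda>_. 1) x"
    unfolding normal_tail_def
    by (subst Bochner_Integration.integral_diff) (auto simp only: integral_std_normal_const integrable_std_normal_const)
  then show ?thesis by simp
qed

text \<open>The ramp \<open>r\<close> is 1 up to \<open>b - d\<close> and 0 from \<open>b\<close>
  on; its continuity makes the Stein solution differentiable, and its normal mean lies between two
  half-line probabilities. The Stein bounds use only that \<open>r\<close> stays in
  \<open>[0, 1]\<close>, so the error does not involve the slope \<open>1 / d\<close>, and
  \<open>d\<close> may be as small as one spacing.\<close>

lemma binomial_normal_ramp: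
  fixes b d :: real
  assumes d: "d > 0"
  defines "r \<equiv> \<lambda>x. max 0 (min 1 ((b - x) / d))"
  obtains u where
    "\<And>j. binomial_node (Suc k) j \<le> u j \<and> u j \<le> binomial_node (Suc k) (Suc j)"
    "(\<Sum>j\<le>k. real (k choose j) / 2 ^ k * r (u j))
       \<le> 1 - normal_tail (\<lambda>_. 1) b + 2 / sqrt (real (Suc k)) * 4"
    "1 - normal_tail (\<lambda>_. 1) (b - d) - 2 / sqrt (real (Suc k)) * 4
       \<le> (\<Sum>j\<le>k. real (k choose j) / 2 ^ k * r (u j))"
proof -
  interpret prob_space std_normal_distribution by (rule prob_space_std_normal)
  have cont: "continuous_on UNIV r" unfolding r_def using d by (intro continuous_intros) auto
  then have [measurable]: "r \<in> borel_measurable borel" by (rule borel_measurable_continuous_onI)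
  have r01: "0 \<le> r x" "r x \<le> 1" for x by (auto simp: r_def)
  have int: "integrable std_normal_distribution r"
    by (rule integrable_const_bound[where B = 1]) (auto simp: r01)
  have int': "integrable std_normal_distribution (\<lambda>x. r (- x))"
    by (rule integrable_const_bound[where B = 1]) (auto simp: r01)
  have int_ind: "integrable std_normal_distribution (\<lambda>t. 1 - indicator {x..} t :: real)" for x
    by (rule integrable_const_bound[where B = 1]) (auto split: split_indicator)
  define c where "c = (\<integral>x. r x \<partial>std_normal_distribution)"
  have "c \<le> (\<integral>t. 1 - indicator {b..} t \<partial>std_normal_distribution)"
    unfolding c_def
  proof (rule integral_mono[OF int int_ind])
    show "r x \<le> 1 - indicator {b..} x" for x
      using r01[of x] d by (auto simp: r_def divide_nonpos_pos split: split_indicator)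
  qed
  then have c_le: "c \<le> 1 - normal_tail (\<lambda>_. 1) b"
    by (simp only: integral_std_normal_one_minus_indicator)
  have "(\<integral>t. 1 - indicator {b - d..} t \<partial>std_normal_distribution) \<le> c"
    unfolding c_def
  proof (rule integral_mono[OF int_ind int])
    show "1 - indicator {b - d..} x \<le> r x" for x
      using r01[of x] d by (auto simp: r_def field_simps split: split_indicator)
  qed
  then have c_ge: "1 - normal_tail (\<lambda>_. 1) (b - d) \<le> c"
    by (simp only: integral_std_normal_one_minus_indicator)
  have "0 \<le> c" unfolding c_def by (rule Bochner_Integration.integral_nonneg) (rule r01)
  moreover have "c \<le> 1" using c_le normal_tail_one_nonneg[of b] by linarith
  ultimately have bound: "\<bar>r x - c\<bar> \<le> 1" for x using r01[of x] by linarith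
  have pos: "\<bar>normal_tail (\<lambda>t. r t - c) x\<bar> \<le> 2 * std_normal_density x"
    "\<bar>(r x - c) * std_normal_density x - x * normal_tail (\<lambda>t. r t - c) x\<bar> \<le> 2 * std_normal_density x"
    if "x \<ge> 0" for x
    by (rule normal_tail_bounds_bounded; use that int bound in auto)+
  have neg: "\<bar>normal_tail (\<lambda>t. r (- t) - c) x\<bar> \<le> 2 * std_normal_density x"
    "\<bar>(r (- x) - c) * std_normal_density x - x * normal_tail (\<lambda>t. r (- t) - c) x\<bar> \<le> 2 * std_normal_density x"
    if "x \<ge> 0" for x
    by (rule normal_tail_bounds_bounded[where K = "\<lambda>t. r (- t) - c"]; use that int' bound in auto)+
  obtain f where "\<And>x. (f has_real_derivative x * f x + (r x - c)) (at x)"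
    "\<And>x. \<bar>f x\<bar> \<le> 2" "\<And>x. \<bar>x * f x + (r x - c)\<bar> \<le> 2"
    by (rule stein_solution[of r 2 2, OF cont int, folded c_def]) (erule pos neg | rule that | assumption)+
  then obtain u where u: "\<And>j. binomial_node (Suc k) j \<le> u j \<and> u j \<le> binomial_node (Suc k) (Suc j)"
    and est: "\<bar>(\<Sum>j\<le>k. real (k choose j) / 2 ^ k * r (u j)) - c\<bar> \<le> 2 / sqrt (real (Suc k)) * (2 + 2)"
    by (rule binomial_stein_comparison[where k = k]) (rule that)
  define s e where "s = (\<Sum>j\<le>k. real (k choose j) / 2 ^ k * r (u j))" and "e = 2 / sqrt (real (Suc k)) * 4"
  have "\<bar>s - c\<bar> \<le> e" using est by (simp add: s_def e_def)
  then have "s \<le> 1 - normal_tail (\<lambda>_. 1) b + e" "1 - normal_tail (\<lambda>_. 1) (b - d) - e \<le> s"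
    using c_le c_ge by linarith+
  then show ?thesis using that[OF u] unfolding s_def e_def by blast
qed

text \<open>This covers \<open>{..z}\<close> and \<open>{..<z}\<close> at once; the latter arises when the other factor of the
  product is negative.\<close>

lemma binomial_normal_halfline:
  assumes m: "m \<ge> 1" and A: "{..<z} \<subseteq> A" "A \<subseteq> {..z}"
  shows "\<bar>binomial_mean m (indicator A) - (\<integral>x. indicator A x \<partial>std_normal_distribution)\<bar> \<le> 10 / sqrt (real m)"
proof -
  obtain k where k: "m = Suc k" using m by (cases m) auto
  define d where "d = 2 / sqrt (real (Suc k))"
  have d: "d > 0" by (simp add: d_def)
  let ?x = "binomial_node (Suc k)"
  have x: "?x (Suc j) = ?x j + d" for j by (simp add: binomial_node_Suc d_def)
  let ?T = "normal_tail (\<lambda>_. 1)"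
  have "A = (if z \<in> A then {..z} else {..<z})" using A by (auto simp: less_le)
  then have [measurable]: "A \<in> sets borel" by (metis atMost_borel lessThan_borel)
  have "(\<integral>x. indicator A x \<partial>std_normal_distribution) = (\<integral>x. 1 - (indicator {z..} x :: real) \<partial>std_normal_distribution)"
    by (intro integral_cong_AE eventually_mono[OF AE_std_normal_neq[of z]])
       (use A in \<open>auto split: split_indicator\<close>)
  then have N: "(\<integral>x. indicator A x \<partial>std_normal_distribution) = 1 - ?T z"
    by (simp only: integral_std_normal_one_minus_indicator)
  \<comment> \<open>The ramp ending at \<open>z + 2 * d\<close> equals 1 up to \<open>z + d\<close>,
    hence at \<open>u j\<close> as soon as one node of the cell is at most \<open>z\<close>. Stein's
    error costs \<open>4 * d\<close>, and shifting the half-line by \<open>2 * d\<close> costs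
    \<open>d\<close>.\<close>
  have "binomial_mean (Suc k) (indicator A) \<le> 1 - ?T z + 5 * d"
  proof -
    obtain u where u: "\<And>j. ?x j \<le> u j \<and> u j \<le> ?x (Suc j)"
      and est: "(\<Sum>j\<le>k. real (k choose j) / 2 ^ k * max 0 (min 1 ((z + 2 * d - u j) / d))) \<le> 1 - ?T (z + 2 * d) + 2 / sqrt (real (Suc k)) * 4"
      by (rule binomial_normal_ramp[OF d, where k = k and b = "z + 2 * d"]) (rule that)
    define v where "v = (\<lambda>j. max 0 (min 1 ((z + 2 * d - u j) / d)))"
    have le: "indicator A (?x i) \<le> v j" if "i = j \<or> i = Suc j" for i j
    proof (cases "?x i \<in> A")
      case True
      then have "?x i \<le> z" using A by auto
      then have "u j \<le> z + d" using that u[of j] x[of j] d by auto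
      then show ?thesis using d by (simp add: v_def field_simps)
    qed (simp add: v_def)
    define s where "s = (\<Sum>j\<le>k. real (k choose j) / 2 ^ k * v j)"
    have "binomial_mean (Suc k) (indicator A) \<le> s + 0"
      unfolding s_def
    proof (rule binomial_mean_le_sum)
      show "(indicator A (?x j) + indicator A (?x (Suc j))) / 2 \<le> v j + 0" for j
        using le[OF disjI1[OF refl], of j] le[OF disjI2[OF refl], of j] by simp
    qed
    moreover have "s \<le> 1 - ?T (z + 2 * d) + d * 4" using est by (simp only: s_def v_def d_def)
    moreover have "?T z \<le> ?T (z + 2 * d) + d"
      using normal_tail_one_increment[of z "z + 2 * d"] d by simp
    ultimately show ?thesis by linarith
  qed
  \<comment> \<open>Dually, the ramp ending at \<open>z - d\<close> vanishes at \<open>u j\<close>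
    as soon as one node of the cell is at least \<open>z\<close>.\<close>
  moreover have "1 - ?T z - 5 * d \<le> binomial_mean (Suc k) (indicator A)"
  proof -
    obtain u where u: "\<And>j. ?x j \<le> u j \<and> u j \<le> ?x (Suc j)"
      and est: "1 - ?T (z - d - d) - 2 / sqrt (real (Suc k)) * 4 \<le> (\<Sum>j\<le>k. real (k choose j) / 2 ^ k * max 0 (min 1 ((z - d - u j) / d)))"
      by (rule binomial_normal_ramp[OF d, where k = k and b = "z - d"]) (rule that)
    define v where "v = (\<lambda>j. max 0 (min 1 ((z - d - u j) / d)))"
    have le: "v j \<le> indicator A (?x i)" if "i = j \<or> i = Suc j" for i j
    proof (cases "?x i \<in> A")
      case False
      then have "?x i \<ge> z" using A by (meson lessThan_iff not_le subsetD)
      then have "u j \<ge> z - d" using that u[of j] x[of j] d by auto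
      then show ?thesis using d by (simp add: v_def divide_nonpos_pos)
    qed (simp add: v_def)
    define s where "s = (\<Sum>j\<le>k. real (k choose j) / 2 ^ k * v j)"
    have "s - 0 \<le> binomial_mean (Suc k) (indicator A)"
      unfolding s_def
    proof (rule binomial_mean_ge_sum)
      show "v j - 0 \<le> (indicator A (?x j) + indicator A (?x (Suc j))) / 2" for j
        using le[OF disjI1[OF refl], of j] le[OF disjI2[OF refl], of j] by simp
    qed
    moreover have "1 - ?T (z - d - d) - d * 4 \<le> s" using est by (simp only: s_def v_def d_def)
    moreover have "?T (z - d - d) \<le> ?T z + d"
      using normal_tail_one_increment[of "z - d - d" z] d by simp
    ultimately show ?thesis by linarith
  qed
  ultimately have "\<bar>binomial_mean (Suc k) (indicator A) - (1 - ?T z)\<bar> \<le> 5 * d" by linarith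
  then show ?thesis unfolding k N d_def by simp
qed

section \<open>From a single factor to the product\<close>

lemma product_comparison:
  fixes h w :: "real \<Rightarrow> real"
  assumes [measurable]: "h \<in> borel_measurable borel"
    and int: "integrable (std_normal_distribution \<Otimes>\<^sub>M std_normal_distribution) (\<lambda>(x, y). h (x * y))"
    and int1: "\<And>t. integrable std_normal_distribution (\<lambda>x. h (x * t))"
    and m: "\<And>t. \<bar>binomial_mean m (\<lambda>x. h (x * t)) - (\<integral>x. h (x * t) \<partial>std_normal_distribution)\<bar> \<le> a * w t"
    and n: "\<And>t. \<bar>binomial_mean n (\<lambda>x. h (x * t)) - (\<integral>x. h (x * t) \<partial>std_normal_distribution)\<bar> \<le> b * w t"
    and w: "binomial_mean n w \<le> 1" "integrable std_normal_distribution w" "(\<integral>x. w x \<partial>std_normal_distribution) \<le> 1"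
    and ab: "a \<ge> 0" "b \<ge> 0"
  shows "\<bar>integral\<^sup>L (W_law m n) h - integral\<^sup>L SVG_110 h\<bar> \<le> a + b"
proof -
  let ?N = std_normal_distribution
  interpret N: prob_space ?N by (rule prob_space_std_normal)
  interpret pair_sigma_finite ?N ?N ..
  define M where "M = binomial_mean n (\<lambda>y. \<integral>x. h (x * y) \<partial>?N)"
  have W: "integral\<^sup>L (W_law m n) h = binomial_mean n (\<lambda>y. binomial_mean m (\<lambda>x. h (x * y)))"
    unfolding integral_W_law binomial_mean_def sum_distrib_left
    by (subst sum.swap) (simp add: mult_ac)
  have "\<bar>integral\<^sup>L (W_law m n) h - M\<bar>
      \<le> binomial_mean n (\<lambda>y. \<bar>binomial_mean m (\<lambda>x. h (x * y)) - (\<integral>x. h (x * y) \<partial>?N)\<bar>)"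
    unfolding W M_def binomial_mean_diff[symmetric] by (rule binomial_mean_abs_le)
  also have "\<dots> \<le> binomial_mean n (\<lambda>y. a * w y)"
    by (rule binomial_mean_mono) (rule m)
  also have "\<dots> \<le> a * 1"
    unfolding binomial_mean_cmult by (intro mult_left_mono w ab)
  finally have first: "\<bar>integral\<^sup>L (W_law m n) h - M\<bar> \<le> a" by simp
  have n': "\<bar>binomial_mean n (\<lambda>y. h (x * y)) - (\<integral>y. h (x * y) \<partial>?N)\<bar> \<le> b * w x" for x
    using n[of x] unfolding mult.commute[of x] .
  have int_j: "integrable ?N (\<lambda>x. real (n choose j) / 2 ^ n * h (x * binomial_node n j))" for j
    by (intro integrable_mult_right int1)
  \<comment> \<open>Interchanging the finite mean with the integral makes the remaining binomial
    factor the inner one, so that hypothesis \<open>n\<close> applies pointwise in the normal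
    factor.\<close>
  have M: "M = (\<integral>x. binomial_mean n (\<lambda>y. h (x * y)) \<partial>?N)"
    unfolding M_def binomial_mean_def
    by (subst Bochner_Integration.integral_sum[OF int_j]) (simp only: integral_mult_right_zero)
  have int_n: "integrable ?N (\<lambda>x. binomial_mean n (\<lambda>y. h (x * y)))"
    unfolding binomial_mean_def by (intro Bochner_Integration.integrable_sum int_j)
  have int_N: "integrable ?N (\<lambda>x. \<integral>y. h (x * y) \<partial>?N)"
    using integrable_fst'[OF int] by simp
  have S: "integral\<^sup>L SVG_110 h = (\<integral>x. \<integral>y. h (x * y) \<partial>?N \<partial>?N)"
    by (rule integral_SVG_110[OF _ int]) simp
  have "\<bar>M - integral\<^sup>L SVG_110 h\<bar> = \<bar>\<integral>x. binomial_mean n (\<lambda>y. h (x * y)) - (\<integral>y. h (x * y) \<partial>?N) \<partial>?N\<bar>"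
    unfolding M S by (simp only: Bochner_Integration.integral_diff[OF int_n int_N])
  also have "\<dots> \<le> (\<integral>x. \<bar>binomial_mean n (\<lambda>y. h (x * y)) - (\<integral>y. h (x * y) \<partial>?N)\<bar> \<partial>?N)"
    by (rule integral_abs_bound)
  also have "\<dots> \<le> (\<integral>x. b * w x \<partial>?N)"
    by (intro integral_mono n' integrable_abs Bochner_Integration.integrable_diff int_n int_N integrable_mult_right w)
  also have "\<dots> \<le> b * 1"
    unfolding integral_mult_right_zero by (intro mult_left_mono w ab)
  finally show ?thesis using first by linarith
qed

lemma wasserstein_bound:
  assumes mn: "m \<ge> 1" "n \<ge> 1" and h: "1-lipschitz_on UNIV h"
  shows "\<bar>integral\<^sup>L (W_law m n) h - integral\<^sup>L SVG_110 h\<bar> \<le> 12 / sqrt (real m) + 12 / sqrt (real n)"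
proof -
  let ?N = std_normal_distribution
  interpret N: prob_space ?N by (rule prob_space_std_normal)
  interpret pair_prob_space ?N ?N ..
  have lip: "\<bar>h s - h t\<bar> \<le> \<bar>s - t\<bar>" for s t
    using lipschitz_onD[OF h, of s t] by (simp add: dist_real_def)
  have [measurable]: "h \<in> borel_measurable borel"
    by (intro borel_measurable_continuous_onI real_lipschitz_continuous lip)
  have growth: "\<bar>h t\<bar> \<le> \<bar>h 0\<bar> + \<bar>t\<bar>" for t using lip[of t 0] by simp
  have int: "integrable (?N \<Otimes>\<^sub>M ?N) (\<lambda>(x, y). h (x * y))"
  proof (rule Bochner_Integration.integrable_bound)
    \<comment> \<open>The dominating function: a product of independent absolute values is
      integrable by Fubini.\<close>
    have "integrable (?N \<Otimes>\<^sub>M ?N) (\<lambda>(x, y). \<bar>x\<bar> * \<bar>y\<bar>)"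
      by (rule Fubini_integrable) (auto simp: abs_mult)
    then show "integrable (?N \<Otimes>\<^sub>M ?N) (\<lambda>p. \<bar>h 0\<bar> + (case p of (x, y) \<Rightarrow> \<bar>x\<bar> * \<bar>y\<bar>))"
      by (intro Bochner_Integration.integrable_add) auto
    show "AE p in ?N \<Otimes>\<^sub>M ?N. norm (case p of (x, y) \<Rightarrow> h (x * y)) \<le> norm (\<bar>h 0\<bar> + (case p of (x, y) \<Rightarrow> \<bar>x\<bar> * \<bar>y\<bar>))"
    proof (rule AE_I2)
      fix p :: "real \<times> real"
      show "norm (case p of (x, y) \<Rightarrow> h (x * y)) \<le> norm (\<bar>h 0\<bar> + (case p of (x, y) \<Rightarrow> \<bar>x\<bar> * \<bar>y\<bar>))"
        using growth[of "fst p * snd p"] by (cases p) (simp add: abs_mult)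
    qed
  qed simp
  have int1: "integrable ?N (\<lambda>x. h (x * t))" for t
  proof (rule Bochner_Integration.integrable_bound)
    show "integrable ?N (\<lambda>x. \<bar>h 0\<bar> + \<bar>x * t\<bar>)" by simp
    show "AE x in ?N. norm (h (x * t)) \<le> norm (\<bar>h 0\<bar> + \<bar>x * t\<bar>)"
      using growth by simp
  qed simp
  \<comment> \<open>For \<open>t \<noteq> 0\<close> the function \<open>h (x * t) / |t|\<close> is
    again 1-Lipschitz in \<open>x\<close>, whence the factor \<open>|t|\<close>; for
    \<open>t = 0\<close> both means equal \<open>h 0\<close>.\<close>
  have scaled: "\<bar>binomial_mean m (\<lambda>x. h (x * t)) - (\<integral>x. h (x * t) \<partial>?N)\<bar> \<le> 12 / sqrt (real m) * \<bar>t\<bar>"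
    if "m \<ge> 1" for m t
  proof (cases "t = 0")
    case True
    then show ?thesis using binomial_mean_const[of m "h 0"] integral_std_normal_const[of "h 0"] by (simp only: mult_zero_right diff_self abs_zero)
  next
    case False
    have "\<bar>binomial_mean m (\<lambda>x. 1 / \<bar>t\<bar> * h (x * t)) - (\<integral>x. 1 / \<bar>t\<bar> * h (x * t) \<partial>?N)\<bar> \<le> 12 / sqrt (real m)"
    proof (rule binomial_normal_lipschitz[OF that])
      show "\<bar>1 / \<bar>t\<bar> * h (x * t) - 1 / \<bar>t\<bar> * h (y * t)\<bar> \<le> \<bar>x - y\<bar>" for x y
      proof -
        have "\<bar>1 / \<bar>t\<bar> * h (x * t) - 1 / \<bar>t\<bar> * h (y * t)\<bar> = 1 / \<bar>t\<bar> * \<bar>h (x * t) - h (y * t)\<bar>"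
          unfolding right_diff_distrib[symmetric] abs_mult by simp
        also have "\<dots> \<le> 1 / \<bar>t\<bar> * \<bar>x * t - y * t\<bar>" by (intro mult_left_mono lip) simp
        also have "\<dots> = \<bar>x - y\<bar>"
          unfolding left_diff_distrib[symmetric] abs_mult using False by simp
        finally show ?thesis .
      qed
    qed
    then have "1 / \<bar>t\<bar> * \<bar>binomial_mean m (\<lambda>x. h (x * t)) - (\<integral>x. h (x * t) \<partial>?N)\<bar> \<le> 12 / sqrt (real m)"
      unfolding binomial_mean_cmult integral_mult_right_zero right_diff_distrib[symmetric] abs_mult by simp
    then show ?thesis using False by (simp add: field_simps)
  qed
  show ?thesis
    by (rule product_comparison[where w = abs])
       (use int int1 scaled mn std_normal_abs_moment_le binomial_mean_abs_id in auto)
qed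

lemma kolmogorov_bound:
  assumes mn: "m \<ge> 1" "n \<ge> 1"
  shows "\<bar>measure (W_law m n) {..z} - measure SVG_110 {..z}\<bar> \<le> 10 / sqrt (real m) + 10 / sqrt (real n)"
proof -
  let ?N = std_normal_distribution
  interpret N: prob_space ?N by (rule prob_space_std_normal)
  interpret pair_prob_space ?N ?N ..
  define h :: "real \<Rightarrow> real" where "h = indicator {..z}"
  have [measurable]: "h \<in> borel_measurable borel" unfolding h_def by simp
  have h1: "\<bar>h x\<bar> \<le> 1" for x by (simp add: h_def split: split_indicator)
  have int: "integrable (?N \<Otimes>\<^sub>M ?N) (\<lambda>(x, y). h (x * y))"
    by (rule P.integrable_const_bound[where B = 1]) (auto simp: h1)
  have int1: "integrable ?N (\<lambda>x. h (x * t))" for t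
    by (rule N.integrable_const_bound[where B = 1]) (auto simp: h1)
  \<comment> \<open>In \<open>x\<close>, the condition \<open>x * t <= z\<close> describes a closed
    lower half-line for \<open>t > 0\<close>, the complement of an open one for
    \<open>t < 0\<close>, and all or nothing for \<open>t = 0\<close>. The half-line bound is
    uniform in its endpoint, so the weight is 1.\<close>
  have scaled: "\<bar>binomial_mean m (\<lambda>x. h (x * t)) - (\<integral>x. h (x * t) \<partial>?N)\<bar> \<le> 10 / sqrt (real m) * 1"
    if m: "m \<ge> 1" for m t
  proof -
    consider "t = 0" | "t > 0" | "t < 0" by linarith
    then show ?thesis
    proof cases
      case 1
      then show ?thesis using binomial_mean_const[of m "h 0"] integral_std_normal_const[of "h 0"]
        by (simp only: mult_zero_right diff_self abs_zero) simp
    next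
      case 2
      then have "(\<lambda>x. h (x * t)) = indicator {..z / t}"
        by (auto simp: h_def fun_eq_iff field_simps split: split_indicator)
      then show ?thesis using binomial_normal_halfline[OF m, of "z / t" "{..z / t}"] by (simp add: subset_iff)
    next
      case 3
      define i :: "real \<Rightarrow> real" where "i = indicator {..<z / t}"
      have eq: "(\<lambda>x. h (x * t)) = (\<lambda>x. 1 - i x)"
        using 3 by (auto simp: h_def i_def fun_eq_iff field_simps split: split_indicator)
      have "integrable ?N i"
        by (rule N.integrable_const_bound[where B = 1]) (auto simp: i_def split: split_indicator)
      then have "(\<integral>x. 1 - i x \<partial>?N) = 1 - (\<integral>x. i x \<partial>?N)"
        by (subst Bochner_Integration.integral_diff) (auto simp only: integral_std_normal_const integrable_std_normal_const)
      moreover have "binomial_mean m (\<lambda>x. 1 - i x) = 1 - binomial_mean m i"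
        unfolding binomial_mean_diff binomial_mean_const ..
      moreover have "\<bar>binomial_mean m i - (\<integral>x. i x \<partial>?N)\<bar> \<le> 10 / sqrt (real m)"
        unfolding i_def by (rule binomial_normal_halfline[OF m, of "z / t"]) auto
      ultimately show ?thesis unfolding eq by simp
    qed
  qed
  have "\<bar>integral\<^sup>L (W_law m n) h - integral\<^sup>L SVG_110 h\<bar> \<le> 10 / sqrt (real m) + 10 / sqrt (real n)"
    by (rule product_comparison[where w = "\<lambda>_. 1"])
       (use int int1 scaled mn binomial_mean_const[of n 1] integral_std_normal_const[of 1] in auto)
  moreover have "integral\<^sup>L (W_law m n) h = measure (W_law m n) {..z}"
    "integral\<^sup>L SVG_110 h = measure SVG_110 {..z}"
    by (simp_all add: h_def W_law_def SVG_110_def)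
  ultimately show ?thesis by simp
qed

section \<open>Comparison of rates and the final bounds\<close>

lemma kolmogorov_rate:
  fixes p q :: real
  assumes "p \<ge> 1" "q \<ge> 1"
  shows "10 / sqrt p + 10 / sqrt q
       \<le> (44.33 + 2.02 * ln (p * q / (p + q))) * (1 / p + 1 / q) powr (1/3)"
proof -
  define d where "d = 1 / p + 1 / q"
  have "1 / p \<le> 1" "1 / q \<le> 1" "1 / p > 0" "1 / q > 0" using assms by auto
  then have d: "d > 0" "d \<le> 2" unfolding d_def by linarith+
  have inv: "p * q / (p + q) = 1 / d" using assms by (simp add: d_def field_simps)
  \<comment> \<open>Since \<open>d <= 2\<close>, the logarithm \<open>ln (1 / d)\<close> is at least
    -1, so the bracket is at least \<open>44.33 - 2.02\<close>, which exceeds 40.\<close>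
  have "ln d \<le> d - 1" using d by (intro ln_le_minus_one)
  then have log: "ln (1 / d) \<ge> - 1" using d by (simp add: ln_div)
  have "1 / sqrt x \<le> d powr (1/2)" if "1 / x \<le> d" "x \<ge> 1" for x
  proof -
    have "1 / sqrt x = sqrt (1 / x)" by (simp add: real_sqrt_divide)
    also have "\<dots> \<le> sqrt d" using that by simp
    finally show ?thesis using d by (simp add: powr_half_sqrt)
  qed
  from this[of p] this[of q] have "10 / sqrt p + 10 / sqrt q \<le> 20 * d powr (1/2)"
    using assms by (simp add: d_def)
  \<comment> \<open>The surplus power \<open>1/6\<close> is bounded crudely by 2, leaving the
    constant \<open>20 * 2 = 40\<close> in front of the claimed power \<open>1/3\<close>.\<close>
  also have "d powr (1/2) = d powr (1/6) * d powr (1/3)" by (simp add: powr_add[symmetric])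
  also have "d powr (1/6) \<le> 2"
  proof -
    have "d powr (1/6) \<le> 2 powr (1/6)" using d by (intro powr_mono2) auto
    also have "\<dots> \<le> 2 powr 1" by (intro powr_mono) auto
    finally show ?thesis by simp
  qed
  also have "20 * (2 * d powr (1/3)) \<le> (44.33 + 2.02 * ln (1 / d)) * d powr (1/3)"
    using log by (subst mult.assoc[symmetric], intro mult_right_mono) auto
  finally have "10 / sqrt p + 10 / sqrt q \<le> (44.33 + 2.02 * ln (1 / d)) * d powr (1/3)"
    by (simp add: mult_right_mono)
  then show ?thesis unfolding inv d_def .
qed

theorem theorem5p8:
  fixes m n :: nat
  assumes "m \<ge> 1" and "n \<ge> 1"
  shows "wasserstein_dist (W_law m n) SVG_110
           \<le> ereal (20.11 * (1 / sqrt (real m) + 1 / sqrt (real n)))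
       \<and> kolmogorov_dist (W_law m n) SVG_110
           \<le> ereal ((44.33 + 2.02 * ln (real m * real n / (real m + real n)))
                    * (1 / real m + 1 / real n) powr (1/3))"
proof
  have "12 / sqrt (real m) + 12 / sqrt (real n) = 12 * (1 / sqrt (real m) + 1 / sqrt (real n))"
    by (simp add: distrib_left)
  also have "\<dots> \<le> 20.11 * (1 / sqrt (real m) + 1 / sqrt (real n))"
    by (intro mult_right_mono) auto
  finally have rate: "12 / sqrt (real m) + 12 / sqrt (real n) \<le> 20.11 * (1 / sqrt (real m) + 1 / sqrt (real n))" .
  show "wasserstein_dist (W_law m n) SVG_110
      \<le> ereal (20.11 * (1 / sqrt (real m) + 1 / sqrt (real n)))"
    unfolding wasserstein_dist_def
  proof (rule SUP_least)
    fix h :: "real \<Rightarrow> real" assume "h \<in> {h. 1-lipschitz_on UNIV h}"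
    then have "1-lipschitz_on UNIV h" by simp
    from order_trans[OF wasserstein_bound[OF assms this] rate]
    show "ereal \<bar>integral\<^sup>L (W_law m n) h - integral\<^sup>L SVG_110 h\<bar>
      \<le> ereal (20.11 * (1 / sqrt (real m) + 1 / sqrt (real n)))"
      by (simp only: ereal_less_eq)
  qed
  show "kolmogorov_dist (W_law m n) SVG_110
      \<le> ereal ((44.33 + 2.02 * ln (real m * real n / (real m + real n)))
               * (1 / real m + 1 / real n) powr (1/3))"
    unfolding kolmogorov_dist_def
  proof (rule SUP_least)
    fix z
    show "ereal \<bar>measure (W_law m n) {..z} - measure SVG_110 {..z}\<bar>
      \<le> ereal ((44.33 + 2.02 * ln (real m * real n / (real m + real n)))
               * (1 / real m + 1 / real n) powr (1/3))"
      using order_trans[OF kolmogorov_bound[OF assms, of z] kolmogorov_rate[of "real m" "real n"]] assms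
      by (simp only: ereal_less_eq real_of_nat_ge_one_iff)
  qed
qed

end
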